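(* Let $l<h$ be such that $h/l\in\Omega(n)$, where $n$ is the number of agents, and suppose that the private valuations take on only the two values $l$ and $h$. There exists a polynomial-time, monotone, constant-fraction welfare-preserving transformation (for downward-closed single-parameter environments).
   Context: A single-parameter environment consists of $n$ agents, where agent $i$ has a private valuation $v_i\in\mathbb{R}$ (its value per unit of stuff that it gets; here $v_i\in\{l,h\}$), and a feasibility set $\mathcal{F}$ whose elements, the feasible allocations, are vectors $\mathbf{x}=(x_i)_{i=1}^n$ with $x_i\in\mathbb{R}$ denoting the amount of stuff given to agent $i$. The environment is downward-closed if, whenever we take an allocation in $\mathcal{F}$ and decrease the amount of stuff given to one of the agents, the resulting allocation is also in $\mathcal{F}$. Constant means not depending on $n$. An algorithm (or allocation rule) $\mathcal{A}$ is a function that takes a valuation vector $\mathbf{v}=(v_i)_{i=1}^n$ (the input) and outputs an allocation $\mathbf{x}\in\mathcal{F}$. The welfare of $\mathcal{A}$ at $\mathbf{v}$ is $\mathbf{v}\cdot\mathbf{x}=v_1x_1+\dots+v_nx_n$. An allocation rule is monotone if, whenever an agent increases its declared valuation while the declared valuations of the remaining agents stay fixed, the agent is allocated at least as much stuff as before. A transformation $\mathcal{T}$ is an algorithm that has black-box access to some other algorithm $\mathcal{A}$: in each query it specifies a valuation vector and obtains the allocation that $\mathcal{A}$ returns there. $\mathcal{T}(\mathcal{A})$ denotes $\mathcal{T}$ with access to $\mathcal{A}$. $\mathcal{T}$ has the knowledge that $\mathcal{F}$ is downward-closed. For this positive result, the transformation does not make queries about membership in $\mathcal{F}$ and is not adaptive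 (it does not adjust its queries based on responses to previous queries). Polynomial means polynomial in $n$. $\mathcal{T}$ is monotone if $\mathcal{T}(\mathcal{A})$ is a monotone allocation rule for any algorithm $\mathcal{A}$. $\mathcal{T}$ is constant-fraction welfare-preserving if, for any algorithm $\mathcal{A}$, $\mathcal{T}(\mathcal{A})$ preserves a constant fraction of the welfare of $\mathcal{A}$ at every input, i.e. for some constant $c>0$ its welfare at every input is at least $c$ times that of $\mathcal{A}$.
   Formalization: Amounts of stuff are taken to be nonnegative, and decreasing an agent's amount stops at 0; with arbitrary real amounts, negative welfare would force exact welfare preservation, which no polynomial-time monotone transformation achieves. *)

theory Defs
  imports
    Complex_Main
    "HOL-Library.Landau_Symbols"
    "HOL-Computational_Algebra.Polynomial"
begin

text \<open>
  Vectors indexed by the n agents are lists of length n, since n varies.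
\<close>

definition valuations :: "real \<Rightarrow> real \<Rightarrow> nat \<Rightarrow> real list set" where
  "valuations lo hi n = {v. length v = n \<and> set v \<subseteq> {lo, hi}}"

text \<open>
  Amounts of stuff are nonnegative, so decreasing an amount stops at 0.  (With negative
  amounts a multiplicative welfare guarantee would degenerate: a constant algorithm with
  negative welfare forces c to be at least 1, one with positive welfare forces c to be at most 1.)
\<close>

definition feasibility_set :: "nat \<Rightarrow> real list set \<Rightarrow> bool" where
  "feasibility_set n F \<longleftrightarrow> (\<forall>x\<in>F. length x = n \<and> (\<forall>i<n. 0 \<le> x ! i))"

definition downward_closed :: "real list set \<Rightarrow> bool" where
  "downward_closed F \<longleftrightarrow>
     (\<forall>x\<in>F. \<forall>i<length x. \<forall>y. 0 \<le> y \<and> y \<le> x ! i \<longrightarrow> x[i := y] \<in> F)"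

definition algorithm ::
    "real \<Rightarrow> real \<Rightarrow> nat \<Rightarrow> real list set \<Rightarrow> (real list \<Rightarrow> real list) \<Rightarrow> bool" where
  "algorithm lo hi n F A \<longleftrightarrow> (\<forall>v\<in>valuations lo hi n. A v \<in> F)"

definition welfare :: "real list \<Rightarrow> real list \<Rightarrow> real" where
  "welfare v x = (\<Sum>i<length v. v ! i * x ! i)"

definition monotone_rule ::
    "real \<Rightarrow> real \<Rightarrow> nat \<Rightarrow> (real list \<Rightarrow> real list) \<Rightarrow> bool" where
  "monotone_rule lo hi n A \<longleftrightarrow>
     (\<forall>v\<in>valuations lo hi n. \<forall>i<n. \<forall>b\<in>{lo, hi}.
        v ! i \<le> b \<longrightarrow> A v ! i \<le> A (v[i := b]) ! i)"

text \<open>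
  The model of computation is a real RAM: natural-number registers (used for counting and
  indexing), multi-dimensional arrays of reals with exact arithmetic and comparison at unit
  cost, rational constants, and an instruction that queries the black box.  A single program
  serves all numbers of agents.  Loops are bounded (their number of iterations is fixed on
  entry) so that execution is a total function; nested bounded loops can still take
  more than polynomial time, so the number of steps is counted.
\<close>

datatype nexp =
    NConst nat
  | NVar string
  | NPlus nexp nexp
  | NMinus nexp nexp

datatype rexp =
    RConst rat
  | RArr string "nexp list"
  | RPlus rexp rexp
  | RMinus rexp rexp
  | RTimes rexp rexp
  | RDiv rexp rexp

datatype bexp =
    NLess nexp nexp
  | RLess rexp rexp
  | BNot bexp
  | BAnd bexp bexp

datatype prog =
    Assign string nexp
  | Store string "nexp list" rexp
  | Seq prog prog
  | Cond bexp prog prog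
  | For string nexp prog
  | Query string string "nexp list"

text \<open>
  The last two fields do not influence execution: they record the number of steps
  and the sequence of queries made so far.
\<close>

record machine =
  regs :: "string \<Rightarrow> nat"
  arrays :: "string \<Rightarrow> nat list \<Rightarrow> real"
  steps :: nat
  queries :: "real list list"

primrec nval :: "nexp \<Rightarrow> machine \<Rightarrow> nat" where
  "nval (NConst k) s = k"
| "nval (NVar x) s = regs s x"
| "nval (NPlus a b) s = nval a s + nval b s"
| "nval (NMinus a b) s = nval a s - nval b s"

primrec rval :: "rexp \<Rightarrow> machine \<Rightarrow> real" where
  "rval (RConst q) s = of_rat q"
| "rval (RArr a es) s = arrays s a (map (\<lambda>e. nval e s) es)"
| "rval (RPlus a b) s = rval a s + rval b s"
| "rval (RMinus a b) s = rval a s - rval b s"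
| "rval (RTimes a b) s = rval a s * rval b s"
| "rval (RDiv a b) s = rval a s / rval b s"

primrec bval :: "bexp \<Rightarrow> machine \<Rightarrow> bool" where
  "bval (NLess a b) s \<longleftrightarrow> nval a s < nval b s"
| "bval (RLess a b) s \<longleftrightarrow> rval a s < rval b s"
| "bval (BNot b) s \<longleftrightarrow> \<not> bval b s"
| "bval (BAnd a b) s \<longleftrightarrow> bval a s \<and> bval b s"

definition tick :: "nat \<Rightarrow> machine \<Rightarrow> machine" where
  "tick k s = s\<lparr>steps := steps s + k\<rparr>"

definition set_reg :: "string \<Rightarrow> nat \<Rightarrow> machine \<Rightarrow> machine" where
  "set_reg x k s = s\<lparr>regs := (regs s)(x := k)\<rparr>"

definition set_cell :: "string \<Rightarrow> nat list \<Rightarrow> real \<Rightarrow> machine \<Rightarrow> machine" where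
  "set_cell a is r s = s\<lparr>arrays := (arrays s)(a := (arrays s a)(is := r))\<rparr>"

definition get_vector :: "nat \<Rightarrow> string \<Rightarrow> machine \<Rightarrow> real list" where
  "get_vector n a s = map (\<lambda>i. arrays s a [i]) [0..<n]"

text \<open>The vector y is written into the row of the array b with index prefix is.\<close>

definition query :: "nat \<Rightarrow> (real list \<Rightarrow> real list) \<Rightarrow> string \<Rightarrow> string \<Rightarrow> nat list
    \<Rightarrow> machine \<Rightarrow> machine" where
  "query n A a b is s =
     (let q = get_vector n a s; y = A q
      in fold (\<lambda>i. set_cell b (is @ [i]) (y ! i)) [0..<n] (s\<lparr>queries := queries s @ [q]\<rparr>))"

text \<open>
  Every instruction, every test and every loop iteration costs one step, and a query costs
  n + 1 steps for passing the vectors.  Expressions are part of the fixed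
  program, so evaluating one takes a constant number of operations.
\<close>

primrec exec :: "nat \<Rightarrow> (real list \<Rightarrow> real list) \<Rightarrow> prog \<Rightarrow> machine \<Rightarrow> machine" where
  "exec n A (Assign x e) s = tick 1 (set_reg x (nval e s) s)"
| "exec n A (Store a es r) s = tick 1 (set_cell a (map (\<lambda>e. nval e s) es) (rval r s) s)"
| "exec n A (Seq p q) s = exec n A q (exec n A p s)"
| "exec n A (Cond b p q) s = (if bval b s then exec n A p (tick 1 s) else exec n A q (tick 1 s))"
| "exec n A (For x e p) s =
     fold (\<lambda>k s'. exec n A p (tick 1 (set_reg x k s'))) [0..<nval e s] (tick 1 s)"
| "exec n A (Query a b es) s = tick (n + 1) (query n A a b (map (\<lambda>e. nval e s) es) s)"

text \<open>
  A program is given the number of agents, the two possible valuations and the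
  valuation vector; all other memory is 0.
\<close>

definition initial :: "real \<Rightarrow> real \<Rightarrow> real list \<Rightarrow> machine" where
  "initial lo hi v =
     \<lparr>regs = (\<lambda>_. 0)(''n'' := length v),
      arrays = (\<lambda>_ _. 0)
        (''l'' := (\<lambda>_. 0)([] := lo),
         ''h'' := (\<lambda>_. 0)([] := hi),
         ''v'' := (\<lambda>is. case is of [i] \<Rightarrow> if i < length v then v ! i else 0 | _ \<Rightarrow> 0)),
      steps = 0,
      queries = []\<rparr>"

definition final ::
    "prog \<Rightarrow> real \<Rightarrow> real \<Rightarrow> (real list \<Rightarrow> real list) \<Rightarrow> real list \<Rightarrow> machine" where
  "final T lo hi A v = exec (length v) A T (initial lo hi v)"

definition transform ::
    "prog \<Rightarrow> real \<Rightarrow> real \<Rightarrow> (real list \<Rightarrow> real list) \<Rightarrow> real list \<Rightarrow> real list" where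
  "transform T lo hi A v = get_vector (length v) ''x'' (final T lo hi A v)"

text \<open>
  The two valuations l n and h n may depend on the number n of agents.  A program has no access
  to the feasibility set, but it must produce a feasible allocation for every downward-closed one.
\<close>

definition instance_of ::
    "(nat \<Rightarrow> real) \<Rightarrow> (nat \<Rightarrow> real) \<Rightarrow> nat \<Rightarrow> real list set \<Rightarrow> (real list \<Rightarrow> real list) \<Rightarrow> bool" where
  "instance_of l h n F A \<longleftrightarrow>
     feasibility_set n F \<and> downward_closed F \<and> algorithm (l n) (h n) n F A"

definition transformation :: "(nat \<Rightarrow> real) \<Rightarrow> (nat \<Rightarrow> real) \<Rightarrow> prog \<Rightarrow> bool" where
  "transformation l h T \<longleftrightarrow>
     (\<forall>n F A. instance_of l h n F A \<longrightarrow>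
        algorithm (l n) (h n) n F (transform T (l n) (h n) A) \<and>
        (\<forall>v\<in>valuations (l n) (h n) n.
           set (queries (final T (l n) (h n) A v)) \<subseteq> valuations (l n) (h n) n))"

definition nonadaptive :: "(nat \<Rightarrow> real) \<Rightarrow> (nat \<Rightarrow> real) \<Rightarrow> prog \<Rightarrow> bool" where
  "nonadaptive l h T \<longleftrightarrow>
     (\<forall>n A A'. \<forall>v\<in>valuations (l n) (h n) n.
        queries (final T (l n) (h n) A v) = queries (final T (l n) (h n) A' v))"

definition polynomial_time :: "(nat \<Rightarrow> real) \<Rightarrow> (nat \<Rightarrow> real) \<Rightarrow> prog \<Rightarrow> bool" where
  "polynomial_time l h T \<longleftrightarrow>
     (\<exists>p :: nat poly. \<forall>n F A. instance_of l h n F A \<longrightarrow>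
        (\<forall>v\<in>valuations (l n) (h n) n. steps (final T (l n) (h n) A v) \<le> poly p n))"

definition monotone_transformation :: "(nat \<Rightarrow> real) \<Rightarrow> (nat \<Rightarrow> real) \<Rightarrow> prog \<Rightarrow> bool" where
  "monotone_transformation l h T \<longleftrightarrow>
     (\<forall>n F A. instance_of l h n F A \<longrightarrow>
        monotone_rule (l n) (h n) n (transform T (l n) (h n) A))"

definition constant_fraction_welfare_preserving ::
    "(nat \<Rightarrow> real) \<Rightarrow> (nat \<Rightarrow> real) \<Rightarrow> prog \<Rightarrow> bool" where
  "constant_fraction_welfare_preserving l h T \<longleftrightarrow>
     (\<exists>c>0. \<forall>n F A. instance_of l h n F A \<longrightarrow>
        (\<forall>v\<in>valuations (l n) (h n) n.
           welfare v (transform T (l n) (h n) A v) \<ge> c * welfare v (A v)))"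

end

theory Submission imports Defs begin

text \<open>
  Zeroing out the low agents costs nothing unless the low agents carry most of the welfare.  Call a
  vector u needy if the best that its high agents obtain from any answer at Hamming distance at
  most 3 is worth less than a small multiple of what A gives to the low agents of u.  At a needy
  vector only low agents are served, from the answer at distance at most 1 that is best for them,
  and only those who get at least half of the average; this loses a factor 2.

  Let j be such an agent and let w arise from u by raising j.  Monotonicity demands that j is served
  at w.  Since h/l is at least of order n, serving j alone at w is worth more than a multiple of
  everything that the low agents of u could get; hence w is not needy.  Two agents j and k cannot
  make demands at the same w: the answer behind the demand of j is at distance at most 3 from the
  vector w with k lowered, where j is high, and as this vector is needy too, its low agents can get
  strictly more from one answer than those of w with j lowered can; exchanging j and k gives a
  contradiction.  So a demand can always be met by serving that single agent (with what A gives it at w,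
  if that is more, since otherwise the welfare of A at w might be lost).  If there is no demand,
  then the best answer for the high agents is used.
\<close>

section \<open>Execution of programs\<close>

primrec written_regs :: "prog \<Rightarrow> string set" where
  "written_regs (Assign x e) = {x}"
| "written_regs (Store a es r) = {}"
| "written_regs (Seq p q) = written_regs p \<union> written_regs q"
| "written_regs (Cond b p q) = written_regs p \<union> written_regs q"
| "written_regs (For x e p) = insert x (written_regs p)"
| "written_regs (Query a b es) = {}"

primrec written_arrays :: "prog \<Rightarrow> string set" where
  "written_arrays (Assign x e) = {}"
| "written_arrays (Store a es r) = {a}"
| "written_arrays (Seq p q) = written_arrays p \<union> written_arrays q"
| "written_arrays (Cond b p q) = written_arrays p \<union> written_arrays q"
| "written_arrays (For x e p) = written_arrays p"
| "written_arrays (Query a b es) = {b}"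

primrec query_free :: "prog \<Rightarrow> bool" where
  "query_free (Assign x e) \<longleftrightarrow> True"
| "query_free (Store a es r) \<longleftrightarrow> True"
| "query_free (Seq p q) \<longleftrightarrow> query_free p \<and> query_free q"
| "query_free (Cond b p q) \<longleftrightarrow> query_free p \<and> query_free q"
| "query_free (For x e p) \<longleftrightarrow> query_free p"
| "query_free (Query a b es) \<longleftrightarrow> False"

lemma machine_access [simp]:
  "regs (tick k s) = regs s" "arrays (tick k s) = arrays s"
  "steps (tick k s) = steps s + k" "queries (tick k s) = queries s"
  "regs (set_reg x m s) = (regs s)(x := m)" "arrays (set_reg x m s) = arrays s"
  "steps (set_reg x m s) = steps s" "queries (set_reg x m s) = queries s"
  "regs (set_cell a is r s) = regs s"
  "arrays (set_cell a is r s) = (arrays s)(a := (arrays s a)(is := r))"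
  "steps (set_cell a is r s) = steps s" "queries (set_cell a is r s) = queries s"
  by (simp_all add: tick_def set_reg_def set_cell_def)

text \<open>The bound is evaluated once, on entry, so the invariant can be indexed by the number of
  completed iterations. With this rule at hand, unfolding a loop into \<open>fold\<close> is kept
  away from the simplifier.\<close>

lemma For_invariant:
  assumes "I 0 (tick 1 s)"
    and "\<And>k t. k < nval e s \<Longrightarrow> I k t \<Longrightarrow> I (Suc k) (exec n A p (tick 1 (set_reg x k t)))"
  shows "I (nval e s) (exec n A (For x e p) s)"
proof -
  have "I m (fold (\<lambda>k s'. exec n A p (tick 1 (set_reg x k s'))) [0..<m] (tick 1 s))"
    if "m \<le> nval e s" for m
    using that by (induction m) (use assms in auto)
  then show ?thesis by simp
qed

declare exec.simps(5) [simp del]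

lemma fold_set_cell:
  defines "F \<equiv> \<lambda>b is y m. fold (\<lambda>i. set_cell b (is @ [i]) (y ! i)) [0..<m]"
  shows "regs (F b is y m s) = regs s" "steps (F b is y m s) = steps s"
    "queries (F b is y m s) = queries s"
    "c \<noteq> b \<Longrightarrow> arrays (F b is y m s) c = arrays s c"
    "arrays (F b is y m s) b js =
       (if \<exists>i<m. js = is @ [i] then y ! last js else arrays s b js)"
  unfolding F_def by (induction m) (auto simp: less_Suc_eq)

lemma query_access [simp]:
  "regs (query n A a b is s) = regs s" "steps (query n A a b is s) = steps s"
  "queries (query n A a b is s) = queries s @ [get_vector n a s]"
  "c \<noteq> b \<Longrightarrow> arrays (query n A a b is s) c = arrays s c"
  "arrays (query n A a b is s) b js =
     (if \<exists>i<n. js = is @ [i] then A (get_vector n a s) ! last js else arrays s b js)"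
  by (auto simp: query_def Let_def fold_set_cell)

lemma exec_regs: "x \<notin> written_regs p \<Longrightarrow> regs (exec n A p s) x = regs s x"
proof (induction p arbitrary: s)
  case (For y e p)
  have "regs (exec n A (For y e p) s) x = regs s x"
    by (rule For_invariant[where I = "\<lambda>k t. regs t x = regs s x"]) (use For in auto)
  then show ?case .
qed auto

lemma exec_arrays: "a \<notin> written_arrays p \<Longrightarrow> arrays (exec n A p s) a = arrays s a"
proof (induction p arbitrary: s)
  case (For y e p)
  have "arrays (exec n A (For y e p) s) a = arrays s a"
    by (rule For_invariant[where I = "\<lambda>k t. arrays t a = arrays s a"]) (use For in auto)
  then show ?case .
qed auto

lemma exec_queries: "query_free p \<Longrightarrow> queries (exec n A p s) = queries s"
proof (induction p arbitrary: s)
  case (For y e p)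
  have "queries (exec n A (For y e p) s) = queries s"
    by (rule For_invariant[where I = "\<lambda>k t. queries t = queries s"]) (use For in auto)
  then show ?case .
qed auto

section \<open>Polynomial bounds on the number of steps\<close>

abbreviation agents :: nexp where
  "agents \<equiv> NVar ''n''"

abbreviation agents_succ :: nexp where
  "agents_succ \<equiv> NPlus (agents) (NConst 1)"

text \<open>A syntactic guarantee of polynomial time: every loop runs \<open>n\<close> or
  \<open>n + 1\<close> times and the register that holds \<open>n\<close> is never overwritten, so
  the nesting depth of the loops governs the degree.\<close>

primrec linear_loops :: "prog \<Rightarrow> bool" where
  "linear_loops (Assign x e) \<longleftrightarrow> x \<noteq> ''n''"
| "linear_loops (Store a es r) \<longleftrightarrow> True"
| "linear_loops (Seq p q) \<longleftrightarrow> linear_loops p \<and> linear_loops q"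
| "linear_loops (Cond b p q) \<longleftrightarrow> linear_loops p \<and> linear_loops q"
| "linear_loops (For x e p) \<longleftrightarrow> x \<noteq> ''n'' \<and> e \<in> {agents, agents_succ} \<and> linear_loops p"
| "linear_loops (Query a b es) \<longleftrightarrow> True"

lemma linear_loops_written: "linear_loops p \<Longrightarrow> ''n'' \<notin> written_regs p"
  by (induction p) auto

lemma linear_loops_polynomial:
  "linear_loops p \<Longrightarrow>
     \<exists>c :: nat poly. \<forall>n A s. regs s ''n'' = n \<longrightarrow> steps (exec n A p s) \<le> steps s + poly c n"
proof (induction p)
  case (Assign x e)
  show ?case by (rule exI[of _ 1]) simp
next
  case (Store a es r)
  show ?case by (rule exI[of _ 1]) simp
next
  case (Query a b es)
  show ?case by (rule exI[of _ "[:1, 1:]"]) simp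
next
  case (Seq p q)
  then obtain c d :: "nat poly"
    where c: "\<And>n A s. regs s ''n'' = n \<Longrightarrow> steps (exec n A p s) \<le> steps s + poly c n"
      and d: "\<And>n A s. regs s ''n'' = n \<Longrightarrow> steps (exec n A q s) \<le> steps s + poly d n"
    by fastforce
  have "steps (exec n A (Seq p q) s) \<le> steps s + poly (c + d) n" if "regs s ''n'' = n" for n A s
    using c[OF that, of A] d[of "exec n A p s" n A] that Seq.prems
    by (simp add: exec_regs linear_loops_written)
  then show ?case by blast
next
  case (Cond b p q)
  then obtain c d :: "nat poly"
    where c: "\<And>n A s. regs s ''n'' = n \<Longrightarrow> steps (exec n A p s) \<le> steps s + poly c n"
      and d: "\<And>n A s. regs s ''n'' = n \<Longrightarrow> steps (exec n A q s) \<le> steps s + poly d n"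
    by fastforce
  have "steps (exec n A (Cond b p q) s) \<le> steps s + poly (1 + c + d) n" if "regs s ''n'' = n" for n A s
    using c[of "tick 1 s" n A] d[of "tick 1 s" n A] that by auto
  then show ?case by blast
next
  case (For x e p)
  then obtain c :: "nat poly"
    where c: "\<And>n A s. regs s ''n'' = n \<Longrightarrow> steps (exec n A p s) \<le> steps s + poly c n"
      and x: "x \<noteq> ''n''" and p: "''n'' \<notin> written_regs p"
    using linear_loops_written by auto
  have "steps (exec n A (For x e p) s) \<le> steps s + poly (1 + [:1, 1:] * (1 + c)) n"
    if n: "regs s ''n'' = n" for n A s
  proof -
    have "regs (exec n A (For x e p) s) ''n'' = n \<and>
        steps (exec n A (For x e p) s) \<le> steps s + 1 + nval e s * (1 + poly c n)"
    proof (rule For_invariant[where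
          I = "\<lambda>k t. regs t ''n'' = n \<and> steps t \<le> steps s + 1 + k * (1 + poly c n)"])
      fix k and t :: machine assume "regs t ''n'' = n \<and> steps t \<le> steps s + 1 + k * (1 + poly c n)"
      then show "regs (exec n A p (tick 1 (set_reg x k t))) ''n'' = n \<and>
          steps (exec n A p (tick 1 (set_reg x k t))) \<le> steps s + 1 + Suc k * (1 + poly c n)"
        using c[of "tick 1 (set_reg x k t)" n A] x p by (simp add: exec_regs)
    qed (use n in simp)
    moreover have "nval e s \<le> n + 1"
      using For.prems n by auto
    then have "nval e s * (1 + poly c n) \<le> (n + 1) * (1 + poly c n)"
      by (rule mult_right_mono) simp
    ultimately show ?thesis by (simp add: algebra_simps)
  qed
  then show ?case by blast
qed

section \<open>Queries that do not depend on the answers\<close>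

primrec arrays_in :: "rexp \<Rightarrow> string set" where
  "arrays_in (RConst q) = {}"
| "arrays_in (RArr a es) = {a}"
| "arrays_in (RPlus a b) = arrays_in a \<union> arrays_in b"
| "arrays_in (RMinus a b) = arrays_in a \<union> arrays_in b"
| "arrays_in (RTimes a b) = arrays_in a \<union> arrays_in b"
| "arrays_in (RDiv a b) = arrays_in a \<union> arrays_in b"

primrec arrays_tested :: "bexp \<Rightarrow> string set" where
  "arrays_tested (NLess a b) = {}"
| "arrays_tested (RLess a b) = arrays_in a \<union> arrays_in b"
| "arrays_tested (BNot b) = arrays_tested b"
| "arrays_tested (BAnd a b) = arrays_tested a \<union> arrays_tested b"

text \<open>Only the array c may depend on the answers of the black box.\<close>

primrec confined :: "string \<Rightarrow> prog \<Rightarrow> bool" where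
  "confined c (Assign x e) \<longleftrightarrow> True"
| "confined c (Store a es r) \<longleftrightarrow> c \<notin> arrays_in r"
| "confined c (Seq p q) \<longleftrightarrow> confined c p \<and> confined c q"
| "confined c (Cond b p q) \<longleftrightarrow> c \<notin> arrays_tested b \<and> confined c p \<and> confined c q"
| "confined c (For x e p) \<longleftrightarrow> confined c p"
| "confined c (Query a b es) \<longleftrightarrow> a \<noteq> c \<and> b = c"

text \<open>Relates runs against two different black boxes, whose answers are kept in
  \<open>c\<close>.\<close>

definition agree_off :: "string \<Rightarrow> machine \<Rightarrow> machine \<Rightarrow> bool" where
  "agree_off c s t \<longleftrightarrow> regs s = regs t \<and> queries s = queries t \<and> (\<forall>a. a \<noteq> c \<longrightarrow> arrays s a = arrays t a)"

lemma nval_cong: "regs s = regs t \<Longrightarrow> nval e s = nval e t"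
  by (induction e) auto

lemma index_agree: "agree_off c s t \<Longrightarrow> map (\<lambda>e. nval e s) es = map (\<lambda>e. nval e t) es"
  by (auto simp: agree_off_def intro: nval_cong)

lemma rval_agree: "agree_off c s t \<Longrightarrow> c \<notin> arrays_in r \<Longrightarrow> rval r s = rval r t"
proof (induction r)
  case (RArr a es)
  then have "arrays s a = arrays t a" by (simp add: agree_off_def)
  then show ?case using index_agree[OF RArr.prems(1), of es] by (simp del: map_eq_conv)
qed auto

lemma bval_agree: "agree_off c s t \<Longrightarrow> c \<notin> arrays_tested b \<Longrightarrow> bval b s = bval b t"
proof (induction b)
  case (NLess x y)
  then show ?case using nval_cong[of s t] by (simp add: agree_off_def)
next
  case (RLess x y)
  then show ?case using rval_agree[of c s t] by simp
qed auto

text \<open>Index expressions and loop bounds read registers only; in a confined program no test, no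
  stored value and no query vector reads \<open>c\<close>, and answers go only into
  \<open>c\<close>. Hence the answers have no way to influence anything else.\<close>

lemma exec_agree:
  "confined c p \<Longrightarrow> agree_off c s t \<Longrightarrow> agree_off c (exec n A p s) (exec n A' p t)"
proof (induction p arbitrary: s t)
  case (Assign x e)
  then have "nval e s = nval e t" by (intro nval_cong) (simp add: agree_off_def)
  with Assign show ?case by (simp add: agree_off_def)
next
  case (Store a es r)
  then have "rval r s = rval r t"
    by (intro rval_agree) auto
  then show ?case
    using Store.prems index_agree[OF Store.prems(2), of es] by (simp add: agree_off_def del: map_eq_conv)
next
  case (Seq p q)
  then show ?case by simp
next
  case (Cond b p q)
  then have "bval b s = bval b t" by (intro bval_agree) auto
  moreover have "agree_off c (tick 1 s) (tick 1 t)" using Cond.prems by (simp add: agree_off_def)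
  ultimately show ?case using Cond by simp
next
  case (For x e p)
  have "nval e s = nval e t"
    using For.prems by (intro nval_cong) (simp add: agree_off_def)
  \<comment> \<open>Equal registers give equal loop bounds, so the two loops run in lockstep and are
    compared after each iteration.\<close>
  moreover have "agree_off c
       (fold (\<lambda>k s'. exec n A p (tick 1 (set_reg x k s'))) [0..<m] (tick 1 s))
       (fold (\<lambda>k s'. exec n A' p (tick 1 (set_reg x k s'))) [0..<m] (tick 1 t))" for m
  proof (induction m)
    case 0
    then show ?case using For.prems by (simp add: agree_off_def)
  next
    case (Suc m)
    have "agree_off c (tick 1 (set_reg x m s')) (tick 1 (set_reg x m t'))"
      if "agree_off c s' t'" for s' t' :: machine
      using that by (simp add: agree_off_def)
    then show ?case using Suc For.prems by (simp add: For.IH)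
  qed
  ultimately show ?case by (simp add: exec.simps(5))
next
  case (Query a b es)
  then have "get_vector n a s = get_vector n a t"
    by (simp add: agree_off_def get_vector_def)
  then show ?case
    using Query.prems index_agree[OF Query.prems(2), of es] by (simp add: agree_off_def del: map_eq_conv)
qed

section \<open>The allocation rule\<close>

text \<open>
  Updating a list out of bounds does nothing, so toggling at the index n leaves the vector as it is,
  and toggling three times covers all vectors at Hamming distance at most 3.
\<close>

definition toggle :: "real \<Rightarrow> real \<Rightarrow> real list \<Rightarrow> nat \<Rightarrow> real list" where
  "toggle lo hi u a = u[a := lo + hi - u ! a]"

text \<open>The indicator of a high valuation, written as a fraction so that the program can compute
  it by arithmetic alone.\<close>

definition high :: "real \<Rightarrow> real \<Rightarrow> real list \<Rightarrow> nat \<Rightarrow> real" where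
  "high lo hi u i = (u ! i - lo) / (hi - lo)"

text \<open>The first maximiser below the bound. The strict comparison is the one made by
  \<open>search_low\<close>, so that both arrive at the same index.\<close>

primrec best_index :: "(nat \<Rightarrow> real) \<Rightarrow> nat \<Rightarrow> nat" where
  "best_index f 0 = 0"
| "best_index f (Suc k) = (if f (best_index f k) < f k then k else best_index f k)"

lemma best_index_less: "0 < k \<Longrightarrow> best_index f k < k"
  by (induction k) (auto simp: less_Suc_eq)

lemma best_index_max: "i < k \<Longrightarrow> f i \<le> f (best_index f k)"
  by (induction k) (fastforce simp: less_Suc_eq)+

text \<open>\<open>\<kappa>\<close> is the small multiple in the needy test. All that is kept of the
  growth of h/l is \<open>ratio\<close>, whose factor 2 n matches the cut-off in
  \<open>low_alloc\<close>; all that is kept of feasibility is \<open>nonneg\<close>.\<close>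

locale two_valued =
  fixes lo hi \<kappa> :: real and n :: nat and A :: "real list \<Rightarrow> real list"
  assumes lo_less_hi: "lo < hi"
    and kappa_pos: "0 < \<kappa>" and kappa_le: "\<kappa> \<le> 1"
    and ratio: "0 < lo \<Longrightarrow> 2 * \<kappa> * real n * lo \<le> hi"
    and nonneg: "u \<in> valuations lo hi n \<Longrightarrow> i < n \<Longrightarrow> 0 \<le> A u ! i"
begin

abbreviation tog :: "real list \<Rightarrow> nat \<Rightarrow> real list" where
  "tog \<equiv> toggle lo hi"

abbreviation chi :: "real list \<Rightarrow> nat \<Rightarrow> real" where
  "chi \<equiv> high lo hi"

abbreviation V :: "real list set" where
  "V \<equiv> valuations lo hi n"

definition high_sum :: "real list \<Rightarrow> real list \<Rightarrow> real" where
  "high_sum u y = (\<Sum>i<n. chi u i * y ! i)"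

definition low_sum :: "real list \<Rightarrow> real list \<Rightarrow> real" where
  "low_sum u y = (\<Sum>i<n. (1 - chi u i) * y ! i)"

definition high_value :: "real list \<Rightarrow> nat \<times> nat \<times> nat \<Rightarrow> real" where
  "high_value u = (\<lambda>(b, c, d). hi * high_sum u (A (tog (tog (tog u b) c) d)))"

definition triples :: "(nat \<times> nat \<times> nat) set" where
  "triples = {..n} \<times> {..n} \<times> {..n}"

text \<open>The value 0 is that of serving nobody, a best choice for the high agents if
  \<open>hi\<close> is negative.\<close>

definition best_high :: "real list \<Rightarrow> real" where
  "best_high u = Max (insert 0 (high_value u ` triples))"

text \<open>If lo is not positive, then the right-hand side is not positive and no vector is needy.\<close>

definition needy :: "real list \<Rightarrow> bool" where
  "needy u \<longleftrightarrow> best_high u < \<kappa> * lo * low_sum u (A u)"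

definition low_value :: "real list \<Rightarrow> nat \<Rightarrow> real" where
  "low_value u b = low_sum u (A (tog u b))"

definition source :: "real list \<Rightarrow> nat" where
  "source u = best_index (low_value u) (Suc n)"

definition low_alloc :: "real list \<Rightarrow> nat \<Rightarrow> real" where
  "low_alloc u i =
     (let z = (1 - chi u i) * A (tog u (source u)) ! i
      in if 2 * real n * z < low_value u (source u) then 0 else z)"

text \<open>A relation and not a function: ties among the triples that attain
  \<open>best_high\<close> are left to the program.\<close>

definition preliminary :: "real list \<Rightarrow> (nat \<Rightarrow> real) \<Rightarrow> bool" where
  "preliminary u r \<longleftrightarrow>
     (if needy u then \<forall>i<n. r i = low_alloc u i
      else (best_high u = 0 \<and> (\<forall>i<n. r i = 0)) \<or>
        (\<exists>b\<le>n. \<exists>c\<le>n. \<exists>d\<le>n. best_high u = high_value u (b, c, d) \<and>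
           (\<forall>i<n. r i = chi u i * A (tog (tog (tog u b) c) d) ! i)))"

definition demand :: "real list \<Rightarrow> nat \<Rightarrow> bool" where
  "demand v k \<longleftrightarrow> k < n \<and> v ! k = hi \<and> needy (tog v k) \<and> 0 < low_alloc (tog v k) k"

text \<open>The existential quantifier leaves the choice among demands open;
  \<open>demand_unique\<close> shows that there is no choice.\<close>

definition outcome :: "real list \<Rightarrow> (nat \<Rightarrow> real) \<Rightarrow> bool" where
  "outcome v x \<longleftrightarrow>
     (if \<exists>k. demand v k
      then \<exists>k. demand v k \<and>
        (\<forall>i<n. x i = (if i = k then max (low_alloc (tog v k) k) (A v ! k) else 0))
      else preliminary v x)"

section \<open>Toggling, high sums and low sums\<close>

lemma length_tog [simp]: "length (tog u a) = length u"
  by (simp add: toggle_def)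

lemma tog_nth: "i < length u \<Longrightarrow> tog u a ! i = (if i = a then lo + hi - u ! a else u ! i)"
  by (auto simp: toggle_def)

lemma tog_tog [simp]: "tog (tog u a) a = u"
  by (cases "a < length u") (auto simp: toggle_def list_update_beyond)

lemma tog_outside [simp]: "length u \<le> a \<Longrightarrow> tog u a = u"
  by (simp add: toggle_def list_update_beyond)

lemma V_length: "u \<in> V \<Longrightarrow> length u = n"
  by (simp add: valuations_def)

lemma V_nth: "u \<in> V \<Longrightarrow> i < n \<Longrightarrow> u ! i = lo \<or> u ! i = hi"
  by (auto simp: valuations_def dest: nth_mem)

lemma tog_V [simp]: "u \<in> V \<Longrightarrow> tog u a \<in> V"
proof (cases "a < length u")
  case True
  assume u: "u \<in> V"
  have "set (tog u a) \<subseteq> insert (lo + hi - u ! a) (set u)"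
    unfolding toggle_def by (rule set_update_subset_insert)
  also have "\<dots> \<subseteq> {lo, hi}"
    using u V_nth[OF u, of a] True by (auto simp: valuations_def)
  finally show ?thesis using u by (simp add: valuations_def)
qed simp

lemma chi_lo: "u ! i = lo \<Longrightarrow> chi u i = 0"
  by (simp add: high_def)

lemma chi_hi: "u ! i = hi \<Longrightarrow> chi u i = 1"
  using lo_less_hi by (simp add: high_def)

lemma chi_cases: "u \<in> V \<Longrightarrow> i < n \<Longrightarrow> chi u i = 0 \<and> u ! i = lo \<or> chi u i = 1 \<and> u ! i = hi"
  using V_nth chi_lo chi_hi by blast

lemma chi_nonneg: "u \<in> V \<Longrightarrow> i < n \<Longrightarrow> 0 \<le> chi u i"
  and chi_le: "u \<in> V \<Longrightarrow> i < n \<Longrightarrow> chi u i \<le> 1"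
  using chi_cases by fastforce+

lemma chi_tog: "u \<in> V \<Longrightarrow> i < n \<Longrightarrow> chi (tog u a) i = (if i = a then 1 - chi u i else chi u i)"
  using lo_less_hi by (simp add: high_def tog_nth V_length field_simps)

lemma low_sum_nonneg: "u \<in> V \<Longrightarrow> w \<in> V \<Longrightarrow> 0 \<le> low_sum u (A w)"
  unfolding low_sum_def by (intro sum_nonneg mult_nonneg_nonneg) (auto simp: nonneg chi_le)

lemma high_sum_nonneg: "u \<in> V \<Longrightarrow> w \<in> V \<Longrightarrow> 0 \<le> high_sum u (A w)"
  unfolding high_sum_def by (intro sum_nonneg mult_nonneg_nonneg) (auto simp: nonneg chi_nonneg)

lemma high_sum_ge: "u \<in> V \<Longrightarrow> w \<in> V \<Longrightarrow> j < n \<Longrightarrow> chi u j * A w ! j \<le> high_sum u (A w)"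
  unfolding high_sum_def by (rule member_le_sum) (auto simp: nonneg chi_nonneg)

lemma welfare_split:
  "v \<in> V \<Longrightarrow> welfare v y = hi * high_sum v y + lo * low_sum v y"
proof -
  assume v: "v \<in> V"
  have "welfare v y = (\<Sum>i<n. hi * (chi v i * y ! i) + lo * ((1 - chi v i) * y ! i))"
    unfolding welfare_def V_length[OF v]
    by (intro sum.cong) (use chi_cases[OF v] in fastforce)+
  then show ?thesis
    by (simp add: sum.distrib sum_distrib_left high_sum_def low_sum_def)
qed

lemma finite_triples [simp]: "finite triples"
  by (simp add: triples_def)

lemma best_high_nonneg: "0 \<le> best_high u"
  unfolding best_high_def by (rule Max_ge) auto

lemma best_high_ge:
  "b \<le> n \<Longrightarrow> c \<le> n \<Longrightarrow> d \<le> n \<Longrightarrow> hi * high_sum u (A (tog (tog (tog u b) c) d)) \<le> best_high u"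
  unfolding best_high_def
  by (rule Max_ge) (auto simp: triples_def high_value_def intro!: image_eqI[of _ _ "(b, c, d)"])

lemma best_high_ge_self: "u \<in> V \<Longrightarrow> hi * high_sum u (A u) \<le> best_high u"
  using best_high_ge[of n n n u] by (simp add: V_length)

lemma low_value_le: "b \<le> n \<Longrightarrow> low_value u b \<le> low_value u (source u)"
  unfolding source_def by (rule best_index_max) simp

lemma source_le: "source u \<le> n"
  unfolding source_def using best_index_less[of "Suc n" "low_value u"] by simp

lemma low_sum_le: "u \<in> V \<Longrightarrow> low_sum u (A u) \<le> low_value u (source u)"
  using low_value_le[of n u] by (simp add: low_value_def V_length)

text \<open>As \<open>best_high\<close> is nonnegative, the strict inequality in
  \<open>needy\<close> makes a product positive in which \<open>\<kappa>\<close> is positive and the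
  low sum is nonnegative.\<close>

lemma needy_pos:
  assumes "u \<in> V" "needy u"
  shows "0 < lo" "0 < low_sum u (A u)" "0 < n"
proof -
  have p: "0 < \<kappa> * (lo * low_sum u (A u))"
    using best_high_nonneg[of u] assms(2) by (simp add: needy_def mult.assoc)
  then have q: "0 < lo * low_sum u (A u)" using kappa_pos by (simp add: zero_less_mult_iff)
  then show "0 < lo" "0 < low_sum u (A u)"
    using low_sum_nonneg[OF assms(1) assms(1)] by (auto simp: zero_less_mult_iff)
  then show "0 < n" unfolding low_sum_def by (intro gr0I) simp
qed

lemma low_alloc_nonneg: "u \<in> V \<Longrightarrow> i < n \<Longrightarrow> 0 \<le> low_alloc u i"
  by (auto simp: low_alloc_def Let_def nonneg chi_le)

lemma low_alloc_le: "u \<in> V \<Longrightarrow> i < n \<Longrightarrow> low_alloc u i \<le> A (tog u (source u)) ! i"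
  using chi_cases[of u i] nonneg[of "tog u (source u)" i] by (auto simp: low_alloc_def Let_def)

lemma low_alloc_high: "u ! i = hi \<Longrightarrow> low_alloc u i = 0"
  by (auto simp: low_alloc_def Let_def chi_hi)

lemma low_alloc_pos:
  assumes "u \<in> V" "j < n" "0 < low_alloc u j"
  shows "low_alloc u j = A (tog u (source u)) ! j"
    and "low_value u (source u) \<le> 2 * real n * low_alloc u j" and "u ! j = lo"
  using assms chi_cases[OF assms(1,2)] by (auto simp: low_alloc_def Let_def split: if_splits)

text \<open>Let G be the best low value. An agent that is cut off loses less than G / (2 n), so all
  of them together lose at most G / 2.\<close>

lemma low_alloc_sum:
  assumes "u \<in> V" "0 < n"
  shows "low_value u (source u) \<le> 2 * (\<Sum>i<n. low_alloc u i)"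
proof -
  define G where "G = low_value u (source u)"
  have "G = (\<Sum>i<n. (1 - chi u i) * A (tog u (source u)) ! i)"
    by (simp add: G_def low_value_def low_sum_def)
  also have "\<dots> \<le> (\<Sum>i<n. low_alloc u i + G / (2 * real n))"
  proof (rule sum_mono)
    fix i assume "i \<in> {..<n}"
    have "0 \<le> G" unfolding G_def low_value_def using assms by (intro low_sum_nonneg) auto
    then show "(1 - chi u i) * A (tog u (source u)) ! i \<le> low_alloc u i + G / (2 * real n)"
      using assms(2) by (auto simp: low_alloc_def Let_def G_def[symmetric] field_simps)
  qed
  also have "\<dots> = (\<Sum>i<n. low_alloc u i) + G / 2"
    using assms(2) by (simp add: sum.distrib)
  finally show ?thesis by (simp add: G_def)
qed

section \<open>Demands and their uniqueness\<close>

lemma served_dominates: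
  assumes u: "u \<in> V" "needy u" and j: "j < n" "0 < low_alloc u j"
  shows "\<kappa> * lo * low_value u (source u) \<le> hi * low_alloc u j"
proof -
  let ?G = "low_value u (source u)"
  have lo: "0 < lo" and n: "0 < n" using needy_pos[OF u] by auto
  \<comment> \<open>An agent that survives the cut-off gets at least \<open>?G\<close> / (2 n), and
    \<open>ratio\<close> absorbs the factor 2 n.\<close>
  have "\<kappa> * lo * ?G \<le> \<kappa> * lo * (2 * real n * low_alloc u j)"
    using low_alloc_pos(2)[OF u(1) j] lo kappa_pos by (intro mult_left_mono) auto
  also have "\<dots> = (2 * \<kappa> * real n * lo) * low_alloc u j" by simp
  also have "\<dots> \<le> hi * low_alloc u j"
    using ratio[OF lo] j by (intro mult_right_mono) auto
  finally show ?thesis .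
qed

text \<open>The answer from which the needy \<open>u\<close> serves \<open>j\<close> is within three
  toggles of \<open>w\<close>, so it competes in \<open>best_high w\<close>; as \<open>j\<close> is
  high at \<open>w\<close>, the amount of \<open>j\<close> alone is worth enough there. Both facts
  about demands below are instances.\<close>

lemma best_high_beside:
  assumes u: "u \<in> V" "needy u" and j: "j < n" "0 < low_alloc u j"
    and w: "w \<in> V" "w ! j = hi"
    and bcd: "b \<le> n" "c \<le> n" "d \<le> n" "tog u (source u) = tog (tog (tog w b) c) d"
  shows "\<kappa> * lo * low_value u (source u) \<le> best_high w"
proof -
  have "\<kappa> * lo * low_value u (source u) \<le> hi * low_alloc u j"
    by (rule served_dominates[OF u j])
  also have "\<dots> = hi * (chi w j * A (tog u (source u)) ! j)"
    using low_alloc_pos(1)[OF u(1) j] chi_hi[of w j] w by simp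
  also have "\<dots> \<le> hi * high_sum w (A (tog u (source u)))"
    using u w j needy_pos[OF u] lo_less_hi by (intro mult_left_mono high_sum_ge) auto
  also have "\<dots> \<le> best_high w"
    using best_high_ge[OF bcd(1-3), of w] bcd(4) by simp
  finally show ?thesis .
qed

lemma low_sum_tog_le:
  assumes "v \<in> V" "w \<in> V" "k < n" "v ! k = hi"
  shows "low_sum v (A w) \<le> low_sum (tog v k) (A w)"
  unfolding low_sum_def
  by (rule sum_mono) (use assms chi_hi[of v k] in \<open>auto simp: chi_tog nonneg intro!: mult_right_mono\<close>)

text \<open>Toggling \<open>k\<close> back leads from the neighbour \<open>tog v k\<close> to
  \<open>v\<close>, so the answer at \<open>v\<close> is among those that the neighbour compares for
  its low agents. Its best low value is thus at least the low sum of \<open>v\<close>, and the agent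
  served out of it keeps \<open>v\<close> from being needy.\<close>

lemma demand_not_needy:
  assumes v: "v \<in> V" and k: "demand v k"
  shows "\<not> needy v"
proof
  assume needy: "needy v"
  let ?u = "tog v k"
  have kn: "k < n" "v ! k = hi" and u: "?u \<in> V" "needy ?u" "0 < low_alloc ?u k"
    using k v by (auto simp: demand_def)
  \<comment> \<open>Toggling \<open>k\<close> and then the source index leads from \<open>v\<close>
    to the answer that serves \<open>k\<close>; the third toggle, at \<open>n\<close>, is
    void.\<close>
  have "\<kappa> * lo * low_value ?u (source ?u) \<le> best_high v"
    using u kn v source_le[of ?u]
    by (intro best_high_beside[where b = k and c = "source ?u" and d = n and j = k])
      (auto simp: V_length)
  also have "\<dots> < \<kappa> * lo * low_sum v (A v)" using needy by (simp add: needy_def)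
  also have "\<dots> \<le> \<kappa> * lo * low_sum ?u (A (tog ?u k))"
    using needy_pos[OF v needy] kappa_pos low_sum_tog_le[OF v v kn] by (intro mult_left_mono) auto
  also have "\<dots> \<le> \<kappa> * lo * low_value ?u (source ?u)"
    using needy_pos[OF v needy] kappa_pos kn low_value_le[of k ?u]
    by (intro mult_left_mono) (auto simp: low_value_def)
  finally show False by simp
qed

lemma demand_unique:
  assumes v: "v \<in> V" and "demand v j" "demand v k"
  shows "j = k"
proof (rule ccontr)
  assume neq: "j \<noteq> k"
  have less: "low_value (tog v j) (source (tog v j)) < low_value (tog v k) (source (tog v k))"
    if "demand v j" "demand v k" "j \<noteq> k" for j k
  proof -
    let ?u = "tog v j" and ?w = "tog v k"
    have j: "j < n" "v ! j = hi" and k: "k < n" and u: "?u \<in> V" "needy ?u" "0 < low_alloc ?u j"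
      and w: "?w \<in> V" "needy ?w"
      using that v by (auto simp: demand_def)
    have "?w ! j = hi" using j k that(3) v by (simp add: tog_nth V_length)
    \<comment> \<open>From \<open>?w\<close>, toggle \<open>k\<close> back, then lower
      \<open>j\<close>, then toggle the source index of \<open>?u\<close>: this is where distance 3
      is used in full.\<close>
    then have "\<kappa> * lo * low_value ?u (source ?u) \<le> best_high ?w"
      using u w j k source_le[of ?u]
      by (intro best_high_beside[where b = k and c = j and d = "source ?u" and j = j]) auto
    also have "\<dots> < \<kappa> * lo * low_sum ?w (A ?w)" using w by (simp add: needy_def)
    also have "\<dots> \<le> \<kappa> * lo * low_value ?w (source ?w)"
      using needy_pos[OF w] kappa_pos low_sum_le[OF w(1)] by (intro mult_left_mono) auto
    finally show ?thesis using needy_pos[OF w] kappa_pos by simp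
  qed
  show False using less[of j k] less[of k j] assms neq by auto
qed

section \<open>Feasibility, monotonicity and welfare of the outcome\<close>

lemma outcome_needy: "v \<in> V \<Longrightarrow> outcome v x \<Longrightarrow> needy v \<Longrightarrow> i < n \<Longrightarrow> x i = low_alloc v i"
  using demand_not_needy[of v] by (auto simp: outcome_def preliminary_def split: if_splits)

lemma outcome_cong:
  assumes "outcome v x" and eq: "\<And>i. i < n \<Longrightarrow> x i = x' i"
  shows "outcome v x'"
proof -
  have "(\<forall>i<n. x i = f i) \<longleftrightarrow> (\<forall>i<n. x' i = f i)" for f :: "nat \<Rightarrow> real"
    using eq by auto
  with assms(1) show ?thesis unfolding outcome_def preliminary_def by (simp only:)
qed

lemma outcome_demand:
  assumes "v \<in> V" "outcome v x" "demand v k" "i < n"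
  shows "x i = (if i = k then max (low_alloc (tog v k) k) (A v ! k) else 0)"
proof -
  obtain l where l: "demand v l"
    "\<forall>i<n. x i = (if i = l then max (low_alloc (tog v l) l) (A v ! l) else 0)"
    using assms(2,3) unfolding outcome_def by (meson assms(3))
  then have "l = k" using demand_unique[OF assms(1) l(1) assms(3)] by simp
  with l assms(4) show ?thesis by simp
qed

text \<open>Being below one single answer is what downward closure turns into feasibility. The
  maximum granted to a demand does no harm: only one agent is served, so whichever answer attains
  the maximum dominates the whole allocation.\<close>

lemma outcome_bounded:
  assumes v: "v \<in> V" and x: "outcome v x"
  shows "\<exists>w\<in>V. \<forall>i<n. 0 \<le> x i \<and> x i \<le> A w ! i"
proof (cases "\<exists>k. demand v k")
  case True
  then obtain k where k: "demand v k"
    and xk: "\<And>i. i < n \<Longrightarrow> x i = (if i = k then max (low_alloc (tog v k) k) (A v ! k) else 0)"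
    using x by (auto simp: outcome_def)
  let ?q = "tog (tog v k) (source (tog v k))"
  have "k < n" using k by (simp add: demand_def)
  then have "low_alloc (tog v k) k \<le> A ?q ! k" "0 \<le> low_alloc (tog v k) k"
    using v by (auto intro: low_alloc_le low_alloc_nonneg)
  then have "(\<forall>i<n. 0 \<le> x i \<and> x i \<le> A v ! i) \<or> (\<forall>i<n. 0 \<le> x i \<and> x i \<le> A ?q ! i)"
    using v xk nonneg by (cases "low_alloc (tog v k) k \<le> A v ! k") auto
  then show ?thesis using v by (metis tog_V)
next
  case False
  then have p: "preliminary v x" using x by (simp add: outcome_def)
  show ?thesis
  proof (cases "needy v")
    case True
    then show ?thesis using p v
      by (intro bexI[of _ "tog v (source v)"]) (auto simp: preliminary_def low_alloc_le low_alloc_nonneg)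
  next
    case False
    then consider "\<forall>i<n. x i = 0"
      | b c d where "\<forall>i<n. x i = chi v i * A (tog (tog (tog v b) c) d) ! i"
      using p by (auto simp: preliminary_def)
    then show ?thesis
    proof cases
      case 1
      then show ?thesis using v nonneg by (intro bexI[of _ v]) auto
    next
      case 2
      then show ?thesis
        using v nonneg chi_nonneg chi_le
        by (intro bexI[of _ "tog (tog (tog v b) c) d"]) (auto intro: mult_left_le_one_le)
    qed
  qed
qed

text \<open>A demand serves a high agent only, and away from needy vectors every preliminary amount
  is zero or carries the indicator of a high valuation as a factor.\<close>

lemma outcome_low:
  assumes v: "v \<in> V" and x: "outcome v x" and i: "i < n" "v ! i = lo" "0 < x i"
  shows "needy v"
proof (rule ccontr)
  assume "\<not> needy v"
  then show False
    using x i lo_less_hi chi_lo[of v i]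
    by (auto simp: outcome_def preliminary_def demand_def split: if_splits)
qed

text \<open>Only the raise of a served low agent matters. Its being served makes \<open>v\<close>
  needy, so it creates a demand at the raised vector, and this grants at least the old amount. The
  assumption \<open>same\<close> is there because \<open>outcome\<close> is a relation: it may admit
  two allocations at one vector.\<close>

lemma outcome_monotone:
  assumes v: "v \<in> V" and x: "outcome v x" and x': "outcome (v[i := b]) x'"
    and i: "i < n" and b: "b \<in> {lo, hi}" "v ! i \<le> b"
    and same: "v[i := b] = v \<Longrightarrow> x' i = x i"
  shows "x i \<le> x' i"
proof (cases "v ! i = b")
  case True
  then show ?thesis using same by (metis list_update_id order_refl)
next
  case False
  then have vi: "v ! i = lo" "b = hi" using V_nth[OF v i] b lo_less_hi by auto
  have w: "v[i := b] = tog v i" by (simp add: toggle_def vi)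
  let ?w = "tog v i"
  have wV: "?w \<in> V" using v by simp
  show ?thesis
  proof (cases "0 < x i")
    case False
    then show ?thesis using outcome_bounded[OF wV, of x'] x' w i by force
  next
    case True
    then have needy: "needy v" using outcome_low[OF v x i vi(1)] by simp
    have xi: "x i = low_alloc v i" by (rule outcome_needy[OF v x needy i])
    have d: "demand ?w i"
      using i needy xi True vi v by (simp add: demand_def tog_nth V_length)
    then show ?thesis using outcome_demand[OF wV _ d, of x' i] x' w i xi by simp
  qed
qed

text \<open>The welfare of \<open>A\<close> is at most 4 times that of \<open>x\<close> at needy
  vectors, 3 / \<open>\<kappa>\<close> times at a demand, and 2 / \<open>\<kappa>\<close> times
  otherwise; as \<open>\<kappa>\<close> is at most 1, the constant covers all three cases.\<close>

lemma outcome_welfare: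
  assumes v: "v \<in> V" and x: "outcome v x"
  shows "\<kappa> / 4 * welfare v (A v) \<le> welfare v (map x [0..<n])"
proof -
  let ?H = "hi * high_sum v (A v)" and ?L = "low_sum v (A v)" and ?x = "map x [0..<n]"
  have W: "welfare v (A v) = ?H + lo * ?L" by (rule welfare_split[OF v])
  have H: "?H \<le> best_high v" by (rule best_high_ge_self[OF v])
  have L: "0 \<le> ?L" by (rule low_sum_nonneg[OF v v])
  have X: "welfare v ?x = (\<Sum>i<n. v ! i * x i)" by (simp add: welfare_def V_length[OF v])
  have goal: "\<kappa> / 4 * welfare v (A v) \<le> B" if "\<kappa> * welfare v (A v) \<le> 4 * B" for B
    using that by simp
  show ?thesis
  proof (cases "needy v")
    case True
    have lo: "0 < lo" and n: "0 < n" using needy_pos[OF v True] by auto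
    have "welfare v ?x = (\<Sum>i<n. lo * low_alloc v i)"
      unfolding X
    proof (rule sum.cong[OF refl])
      fix i assume "i \<in> {..<n}"
      then show "v ! i * x i = lo * low_alloc v i"
        using outcome_needy[OF v x True] V_nth[OF v, of i] low_alloc_high[of v i] by auto
    qed
    then have "2 * welfare v ?x = lo * (2 * (\<Sum>i<n. low_alloc v i))"
      by (simp add: sum_distrib_left mult_ac)
    moreover have "lo * ?L \<le> lo * (2 * (\<Sum>i<n. low_alloc v i))"
      using low_alloc_sum[OF v n] low_sum_le[OF v] lo by (intro mult_left_mono) auto
    ultimately have a: "lo * ?L \<le> 2 * welfare v ?x" by simp
    \<comment> \<open>At a needy vector the high agents contribute less to the welfare of
      \<open>A\<close> than the low ones, so dropping them costs at most a second factor 2.\<close>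
    have "?H < \<kappa> * (lo * ?L)" using H True by (simp add: needy_def mult.assoc)
    moreover have "\<kappa> * (lo * ?L) \<le> lo * ?L"
      using kappa_le kappa_pos lo L by (intro mult_left_le_one_le) auto
    ultimately have "welfare v (A v) \<le> 4 * welfare v ?x" using W a by linarith
    moreover have "0 \<le> welfare v (A v)"
      unfolding W using lo lo_less_hi L high_sum_nonneg[OF v v] by simp
    ultimately have "\<kappa> * welfare v (A v) \<le> 4 * welfare v ?x"
      using kappa_le kappa_pos by (smt (verit) mult_left_le_one_le)
    then show ?thesis by (rule goal)
  next
    case nn: False
    show ?thesis
    proof (cases "\<exists>k. demand v k")
      case True
      then obtain k where k: "demand v k"
        and xk: "\<And>i. i < n \<Longrightarrow> x i = (if i = k then max (low_alloc (tog v k) k) (A v ! k) else 0)"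
        using x by (auto simp: outcome_def)
      let ?u = "tog v k"
      let ?G = "low_value ?u (source ?u)"
      have kn: "k < n" "v ! k = hi" and u: "?u \<in> V" "needy ?u" and pos: "0 < low_alloc ?u k"
        using k v by (auto simp: demand_def)
      have lo: "0 < lo" "0 < hi" using needy_pos[OF u] lo_less_hi by auto
      have "welfare v ?x = (\<Sum>i<n. if i = k then hi * x k else 0)"
        unfolding X by (intro sum.cong) (auto simp: xk kn)
      then have Wx: "welfare v ?x = hi * x k" using kn by simp
      have "\<kappa> * lo * ?G \<le> hi * low_alloc ?u k"
        by (rule served_dominates[OF u kn(1) pos])
      also have "\<dots> \<le> hi * x k" using xk[OF kn(1)] lo by (intro mult_left_mono) auto
      finally have dom: "\<kappa> * (lo * ?G) \<le> hi * x k" by (simp add: mult.assoc)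
      have "?L \<le> low_sum ?u (A (tog ?u k))" using low_sum_tog_le[OF v v kn] by simp
      also have "\<dots> \<le> ?G" using low_value_le[of k ?u] kn by (simp add: low_value_def)
      finally have "lo * ?L \<le> lo * ?G" using lo by simp
      then have "\<kappa> * (lo * ?L) \<le> \<kappa> * (lo * ?G)" using kappa_pos by (simp add: mult_left_mono)
      then have l: "\<kappa> * (lo * ?L) \<le> hi * x k" using dom by linarith
      \<comment> \<open>Agent \<open>k\<close> is split off. The other high agents of
        \<open>v\<close> are those of the needy neighbour, in whose \<open>best_high\<close> the
        answer at \<open>v\<close> competes; \<open>k\<close> itself is covered by the maximum in
        \<open>outcome\<close>.\<close>
      have "high_sum v (A v) = (\<Sum>i<n. chi ?u i * A v ! i + (if i = k then A v ! k else 0))"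
        unfolding high_sum_def
        by (intro sum.cong) (use v kn chi_hi[of v k] in \<open>auto simp: chi_tog\<close>)
      then have "high_sum v (A v) = high_sum ?u (A v) + A v ! k"
        using kn by (simp add: sum.distrib high_sum_def)
      moreover have "hi * high_sum ?u (A v) \<le> best_high ?u"
        using best_high_ge[of k n n ?u] kn v by (simp add: V_length)
      moreover have "best_high ?u < \<kappa> * lo * low_sum ?u (A ?u)" using u by (simp add: needy_def)
      moreover have "\<kappa> * lo * low_sum ?u (A ?u) \<le> \<kappa> * lo * ?G"
        using low_sum_le[OF u(1)] kappa_pos lo by (intro mult_left_mono) auto
      moreover have "hi * A v ! k \<le> hi * x k" using xk[OF kn(1)] lo by (intro mult_left_mono) auto
      ultimately have h: "?H \<le> 2 * (hi * x k)" using dom by (simp add: algebra_simps)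
      have H0: "0 \<le> ?H" using lo high_sum_nonneg[OF v v] by simp
      then have "\<kappa> * ?H \<le> ?H" using kappa_le kappa_pos by (intro mult_left_le_one_le) auto
      then have "\<kappa> * welfare v (A v) \<le> 4 * (hi * x k)"
        unfolding W distrib_left using l h H0 by linarith
      then show ?thesis unfolding Wx by (rule goal)
    next
      case False
      then have p: "preliminary v x" using x by (simp add: outcome_def)
      have Wx: "welfare v ?x = best_high v"
      proof -
        consider "best_high v = 0" "\<forall>i<n. x i = 0"
          | b c d where "best_high v = high_value v (b, c, d)"
            "\<forall>i<n. x i = chi v i * A (tog (tog (tog v b) c) d) ! i"
          using p nn by (auto simp: preliminary_def)
        then show ?thesis
        proof cases
          case 1
          then show ?thesis unfolding X by simp
        next
          case 2
          have "welfare v ?x = (\<Sum>i<n. hi * (chi v i * A (tog (tog (tog v b) c) d) ! i))"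
            unfolding X by (intro sum.cong) (use 2 chi_cases[OF v] in fastforce)+
          then show ?thesis using 2 by (simp add: high_value_def high_sum_def sum_distrib_left)
        qed
      qed
      \<comment> \<open>\<open>?H\<close> may be negative if \<open>hi\<close> is, so the factor
        \<open>\<kappa>\<close> is dropped only after passing to the nonnegative
        \<open>best_high v\<close>.\<close>
      have "\<kappa> * ?H \<le> best_high v"
        using mult_left_mono[OF H, of \<kappa>] mult_left_le_one_le[OF best_high_nonneg[of v], of \<kappa>]
          kappa_le kappa_pos by linarith
      moreover have "\<kappa> * (lo * ?L) \<le> best_high v" using nn by (simp add: needy_def mult.assoc)
      ultimately have "\<kappa> * welfare v (A v) \<le> 4 * best_high v"
        unfolding W distrib_left using best_high_nonneg[of v] by linarith
      then show ?thesis unfolding Wx by (rule goal)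
    qed
  qed
qed

end

section \<open>The program\<close>

abbreviation cell :: "string \<Rightarrow> string list \<Rightarrow> rexp" where
  "cell a xs \<equiv> RArr a (map NVar xs)"

abbreviation skip :: prog where
  "skip \<equiv> Assign ''z'' (NConst 0)"

abbreviation for_agents :: "prog \<Rightarrow> prog" where
  "for_agents \<equiv> For ''i'' (agents)"

definition flip :: "string \<Rightarrow> prog" where
  "flip x = Store ''u'' [NVar x] (RMinus (RPlus (RArr ''l'' []) (RArr ''h'' [])) (RArr ''u'' [NVar x]))"

text \<open>The second \<open>flip\<close> undoes the first. In the last round the index is
  \<open>n\<close>: a cell behind the vector is flipped, and the body sees the vector
  itself.\<close>

definition with_flips :: "string \<Rightarrow> prog \<Rightarrow> prog" where
  "with_flips x p = For x agents_succ (Seq (flip x) (Seq p (flip x)))"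

definition total :: "rexp \<Rightarrow> prog" where
  "total e = Seq (Store ''s'' [] (RConst 0)) (for_agents (Store ''s'' [] (RPlus (RArr ''s'' []) e)))"

definition high_exp :: rexp where
  "high_exp = RDiv (RMinus (RArr ''u'' [NVar ''i'']) (RArr ''l'' [])) (RMinus (RArr ''h'' []) (RArr ''l'' []))"

definition low_exp :: rexp where
  "low_exp = RMinus (RConst 1) high_exp"

definition answer :: "nexp list \<Rightarrow> rexp" where
  "answer es = RArr ''y'' (es @ [NVar ''i''])"

text \<open>The outermost toggle leads to a neighbour of the input or to the input itself; the three
  inner ones reach the answers that enter the needy test there.\<close>

definition ask :: prog where
  "ask = Seq (for_agents (Store ''u'' [NVar ''i''] (RArr ''v'' [NVar ''i''])))
     (with_flips ''a'' (with_flips ''b'' (with_flips ''c'' (with_flips ''d''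
        (Query ''u'' ''y'' [NVar ''a'', NVar ''b'', NVar ''c'', NVar ''d''])))))"

text \<open>The loops vary only the index of the recorded answer, while \<open>u\<close> keeps the
  vector under examination, to which \<open>high_exp\<close> refers. Starting with value 0 and zero
  amounts accounts for the 0 inserted in \<open>best_high\<close>.\<close>

definition search_high :: prog where
  "search_high =
     (let y = RTimes high_exp (answer [NVar ''a'', NVar ''b'', NVar ''c'', NVar ''d'']);
          z = RTimes (RArr ''h'' []) (RArr ''s'' [])
      in Seq (Store ''m'' [] (RConst 0)) (Seq (for_agents (Store ''p'' [NVar ''i''] (RConst 0)))
        (For ''b'' agents_succ (For ''c'' agents_succ (For ''d'' agents_succ
          (Seq (total y)
             (Cond (RLess (RArr ''m'' []) z)
               (Seq (Store ''m'' [] z) (for_agents (Store ''p'' [NVar ''i''] y)))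
               skip)))))))"

text \<open>An index \<open>agents\<close> stands for a void toggle, so the answers compared are
  those at distance at most 1 from the vector in \<open>u\<close>.\<close>

definition search_low :: prog where
  "search_low =
     Seq (Assign ''k'' (NConst 0)) (Seq (Store ''g'' [] (RConst 0))
       (For ''b'' agents_succ
         (Seq (total (RTimes low_exp (answer [NVar ''a'', NVar ''b'', agents, agents])))
           (Cond (RLess (RArr ''g'' []) (RArr ''s'' []))
             (Seq (Assign ''k'' (NVar ''b'')) (Store ''g'' [] (RArr ''s'' [])))
             skip))))"

text \<open>
  The language has no conversion of natural numbers to reals, so the number of agents is
  obtained as a sum of ones.
\<close>

definition serve_low :: "rat \<Rightarrow> prog" where
  "serve_low q =
     (let y = RTimes low_exp (answer [NVar ''a'', NVar ''k'', agents, agents])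
      in Seq (total (RConst 1)) (Seq (Store ''c'' [] (RArr ''s'' []))
        (Seq (total (RTimes low_exp (answer [NVar ''a'', agents, agents, agents])))
          (Cond (RLess (RArr ''m'' []) (RTimes (RTimes (RConst q) (RArr ''l'' [])) (RArr ''s'' [])))
            (for_agents
              (Cond (RLess (RTimes (RTimes (RConst 2) (RArr ''c'' [])) y) (RArr ''g'' []))
                (Store ''p'' [NVar ''i''] (RConst 0))
                (Store ''p'' [NVar ''i''] y)))
            skip))))"

text \<open>\<open>search_high\<close> leaves its allocation in \<open>p\<close>, and
  \<open>serve_low\<close> overwrites it exactly when the vector is needy; what is then copied is a
  preliminary allocation.\<close>

definition prepare :: "rat \<Rightarrow> prog" where
  "prepare q =
     with_flips ''a'' (Seq search_high (Seq search_low (Seq (serve_low q)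
       (for_agents (Store ''r'' [NVar ''a'', NVar ''i''] (RArr ''p'' [NVar ''i'']))))))"

text \<open>
  The array r holds the preliminary allocations of v (row n) and of its neighbours.  In row a a high
  agent a of v is low, so its entry is positive only if that neighbour is needy and serves it.
\<close>

definition decide :: prog where
  "decide =
     Seq (for_agents (Store ''x'' [NVar ''i''] (RArr ''r'' [agents, NVar ''i''])))
       (For ''a'' agents
         (Cond (BAnd (RLess (RArr ''l'' []) (RArr ''v'' [NVar ''a'']))
                     (RLess (RConst 0) (RArr ''r'' [NVar ''a'', NVar ''a''])))
           (Seq (for_agents (Store ''x'' [NVar ''i''] (RConst 0)))
             (Seq (Store ''x'' [NVar ''a''] (RArr ''r'' [NVar ''a'', NVar ''a'']))
               (Cond (RLess (RArr ''x'' [NVar ''a'']) (RArr ''y'' [agents, agents, agents, agents, NVar ''a'']))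
                 (Store ''x'' [NVar ''a''] (RArr ''y'' [agents, agents, agents, agents, NVar ''a'']))
                 skip)))
           skip))"

definition serve_demands :: "rat \<Rightarrow> prog" where
  "serve_demands q = Seq ask (Seq (prepare q) decide)"

lemmas program_defs = flip_def with_flips_def total_def high_exp_def low_exp_def answer_def
  ask_def search_high_def search_low_def serve_low_def prepare_def decide_def serve_demands_def Let_def

section \<open>Nonadaptivity and running time of the program\<close>

lemma linear_loops_serve_demands: "linear_loops (serve_demands q)"
  by (simp add: program_defs)

lemma confined_ask: "confined ''y'' ask"
  by (simp add: program_defs)

lemma query_free_rest: "query_free (prepare q)" "query_free decide"
  by (simp_all add: program_defs)

text \<open>All queries are made by \<open>ask\<close>, which is confined to \<open>y\<close>; the
  later phases work on the recorded answers.\<close>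

lemma nonadaptive_serve_demands: "nonadaptive l h (serve_demands q)"
proof -
  have "agree_off ''y'' (exec n A ask s) (exec n A' ask s)" for n A A' s
    by (rule exec_agree[OF confined_ask]) (simp add: agree_off_def)
  then show ?thesis
    by (simp add: nonadaptive_def final_def serve_demands_def exec_queries query_free_rest agree_off_def)
qed

lemma polynomial_time_serve_demands: "polynomial_time l h (serve_demands q)"
proof -
  obtain c :: "nat poly" where c: "\<And>n A s. regs s ''n'' = n \<Longrightarrow>
      steps (exec n A (serve_demands q) s) \<le> steps s + poly c n"
    using linear_loops_polynomial[OF linear_loops_serve_demands, of q] by blast
  have "steps (final (serve_demands q) lo hi A v) \<le> poly c (length v)" for lo hi A v
    using c[of "initial lo hi v" "length v" A] by (simp add: final_def initial_def)
  then show ?thesis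
    unfolding polynomial_time_def valuations_def by (intro exI[of _ c]) auto
qed

section \<open>Correctness of the program\<close>

definition unchanged :: "string set \<Rightarrow> string set \<Rightarrow> machine \<Rightarrow> machine \<Rightarrow> bool" where
  "unchanged R B s t \<longleftrightarrow>
     (\<forall>x. x \<notin> R \<longrightarrow> regs t x = regs s x) \<and> (\<forall>a. a \<notin> B \<longrightarrow> arrays t a = arrays s a)"

lemma unchanged_trans:
  "unchanged R B s t \<Longrightarrow> unchanged R' B' t u \<Longrightarrow> R' \<subseteq> R \<Longrightarrow> B' \<subseteq> B \<Longrightarrow> unchanged R B s u"
  unfolding unchanged_def by (metis subsetD)

text \<open>The invariant is indexed by the set of items treated so far instead of the loop counter,
  so that nested loops share one invariant and an inner loop just contributes a larger increment.
  \<open>cong\<close> makes it independent of counters and step counts.\<close>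

lemma For_collect:
  assumes init: "I D s"
    and step: "\<And>k D t. k < nval e s \<Longrightarrow>
      unchanged (insert x (written_regs p)) (written_arrays p) s t \<Longrightarrow> regs t x = k \<Longrightarrow>
      I D t \<Longrightarrow> I (D \<union> E k) (exec n A p t)"
    and cong: "\<And>D t t'. arrays t' = arrays t \<Longrightarrow> I D t \<Longrightarrow> I D t'"
  shows "I (D \<union> (\<Union>k<nval e s. E k)) (exec n A (For x e p) s)"
proof -
  have "I (D \<union> (\<Union>j<nval e s. E j)) (exec n A (For x e p) s) \<and>
      unchanged (insert x (written_regs p)) (written_arrays p) s (exec n A (For x e p) s)"
  proof (rule For_invariant[where I = "\<lambda>k t. I (D \<union> (\<Union>j<k. E j)) t \<and>
        unchanged (insert x (written_regs p)) (written_arrays p) s t"])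
    show "I (D \<union> (\<Union>j<0. E j)) (tick 1 s) \<and>
        unchanged (insert x (written_regs p)) (written_arrays p) s (tick 1 s)"
      using cong[of "tick 1 s" s, OF _ init] by (simp add: unchanged_def)
  next
    fix k t
    assume k: "k < nval e s" and t: "I (D \<union> (\<Union>j<k. E j)) t \<and>
      unchanged (insert x (written_regs p)) (written_arrays p) s t"
    let ?t = "tick 1 (set_reg x k t)"
    have "I (D \<union> (\<Union>j<k. E j) \<union> E k) (exec n A p ?t)"
      using t cong[of ?t t] by (intro step[OF k]) (auto simp: unchanged_def)
    then show "I (D \<union> (\<Union>j<Suc k. E j)) (exec n A p ?t) \<and>
        unchanged (insert x (written_regs p)) (written_arrays p) s (exec n A p ?t)"
      using t by (auto simp: lessThan_Suc Un_ac unchanged_def exec_regs exec_arrays)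
  qed
  then show ?thesis ..
qed

lemma exec_total:
  assumes n: "regs s ''n'' = n"
    and e: "\<And>k t. k < n \<Longrightarrow> unchanged {''i''} {''s''} s t \<Longrightarrow> regs t ''i'' = k \<Longrightarrow> rval e t = f k"
  shows "arrays (exec n A (total e) s) ''s'' [] = (\<Sum>k<n. f k)"
    and "unchanged {''i''} {''s''} s (exec n A (total e) s)"
proof -
  define s0 where "s0 = exec n A (Store ''s'' [] (RConst 0)) s"
  define p where "p = Store ''s'' [] (RPlus (RArr ''s'' []) e)"
  have "unchanged {''i''} {''s''} s (exec n A (for_agents p) s0) \<and>
      arrays (exec n A (for_agents p) s0) ''s'' [] = (\<Sum>k<nval agents s0. f k)"
  proof (rule For_invariant[where
        I = "\<lambda>m t. unchanged {''i''} {''s''} s t \<and> arrays t ''s'' [] = (\<Sum>k<m. f k)"])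
    fix k t
    assume "k < nval agents s0"
      and t: "unchanged {''i''} {''s''} s t \<and> arrays t ''s'' [] = (\<Sum>k<k. f k)"
    then have "rval e (tick 1 (set_reg ''i'' k t)) = f k"
      using n by (intro e) (auto simp: s0_def unchanged_def)
    then show "unchanged {''i''} {''s''} s (exec n A p (tick 1 (set_reg ''i'' k t))) \<and>
        arrays (exec n A p (tick 1 (set_reg ''i'' k t))) ''s'' [] = (\<Sum>k<Suc k. f k)"
      using t by (simp add: p_def unchanged_def)
  qed (simp add: s0_def unchanged_def)
  moreover have "exec n A (total e) s = exec n A (for_agents p) s0"
    by (simp add: total_def p_def s0_def)
  moreover have "nval agents s0 = n" using n by (simp add: s0_def)
  ultimately show "arrays (exec n A (total e) s) ''s'' [] = (\<Sum>k<n. f k)"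
    "unchanged {''i''} {''s''} s (exec n A (total e) s)" by simp_all
qed

text \<open>\<open>pre\<close> is the row of a multi-dimensional array that the loop fills; it is
  empty when a plain vector is written.\<close>

lemma exec_for_agents:
  assumes n: "regs s ''n'' = n"
    and p: "written_regs p = {}" "written_arrays p = {a}"
    and step: "\<And>k t. k < n \<Longrightarrow> unchanged {''i''} {a} s t \<Longrightarrow> regs t ''i'' = k \<Longrightarrow>
      arrays (exec n A p t) a = (arrays t a)(pre @ [k] := f k)"
  shows "arrays (exec n A (for_agents p) s) a =
      (\<lambda>js. if \<exists>k<n. js = pre @ [k] then f (last js) else arrays s a js)"
    and "unchanged {''i''} {a} s (exec n A (for_agents p) s)"
proof -
  have "unchanged {''i''} {a} s (exec n A (for_agents p) s) \<and>
      arrays (exec n A (for_agents p) s) a =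
        (\<lambda>js. if \<exists>k<nval agents s. js = pre @ [k] then f (last js) else arrays s a js)"
  proof (rule For_invariant[where I = "\<lambda>m t. unchanged {''i''} {a} s t \<and>
      arrays t a = (\<lambda>js. if \<exists>k<m. js = pre @ [k] then f (last js) else arrays s a js)"])
    fix k t
    assume k: "k < nval agents s"
      and t: "unchanged {''i''} {a} s t \<and>
        arrays t a = (\<lambda>js. if \<exists>j<k. js = pre @ [j] then f (last js) else arrays s a js)"
    let ?t = "tick 1 (set_reg ''i'' k t)"
    have "arrays (exec n A p ?t) a = (arrays ?t a)(pre @ [k] := f k)"
      using k t n by (intro step) (auto simp: unchanged_def)
    moreover have "unchanged {''i''} {a} s (exec n A p ?t)"
      using t p by (auto simp: unchanged_def exec_regs exec_arrays)
    ultimately show "unchanged {''i''} {a} s (exec n A p ?t) \<and> arrays (exec n A p ?t) a =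
        (\<lambda>js. if \<exists>j<Suc k. js = pre @ [j] then f (last js) else arrays s a js)"
      using t by (auto simp: less_Suc_eq fun_eq_iff)
  qed (simp add: unchanged_def)
  then show "arrays (exec n A (for_agents p) s) a =
      (\<lambda>js. if \<exists>k<n. js = pre @ [k] then f (last js) else arrays s a js)"
    "unchanged {''i''} {a} s (exec n A (for_agents p) s)" using n by auto
qed

section \<open>Machine states and the recorded answers\<close>

context two_valued
begin

text \<open>\<open>w\<close> is the current content of the working vector \<open>u\<close>, as
  opposed to the input. The cell at \<open>n\<close>, which void toggles alter, is left
  unconstrained.\<close>

definition holds :: "real list \<Rightarrow> machine \<Rightarrow> bool" where
  "holds w s \<longleftrightarrow> regs s ''n'' = n \<and> arrays s ''l'' [] = lo \<and> arrays s ''h'' [] = hi \<and>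
     (\<forall>i<n. arrays s ''u'' [i] = w ! i)"

definition answered :: "real list \<Rightarrow> (nat \<times> nat \<times> nat \<times> nat) set \<Rightarrow> machine \<Rightarrow> bool" where
  "answered v D s \<longleftrightarrow> (\<forall>(a, b, c, d)\<in>D. \<forall>i<n.
     arrays s ''y'' [a, b, c, d, i] = A (tog (tog (tog (tog v a) b) c) d) ! i)"

lemma holds_flip:
  assumes "holds w s" "length w = n"
  shows "holds (tog w (regs s x)) (exec n B (flip x) s)"
  using assms by (auto simp: holds_def flip_def tog_nth)

text \<open>The counterpart of \<open>For_collect\<close> for flipped loops: the body runs on the
  toggled vector, \<open>w\<close> is back afterwards, and \<open>cong\<close> demands that the
  invariant ignore \<open>u\<close>.\<close>

lemma with_flips_collect:
  assumes init: "I D s" and w: "holds w s" "length w = n"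
    and step: "\<And>k D t. k \<le> n \<Longrightarrow>
      unchanged (insert x (written_regs p)) (insert ''u'' (written_arrays p)) s t \<Longrightarrow>
      regs t x = k \<Longrightarrow> holds (tog w k) t \<Longrightarrow> I D t \<Longrightarrow>
      I (D \<union> E k) (exec n A p t) \<and> holds (tog w k) (exec n A p t)"
    and x: "x \<noteq> ''n''" "x \<notin> written_regs p"
    and cong: "\<And>D t t'. (\<And>a. a \<noteq> ''u'' \<Longrightarrow> arrays t' a = arrays t a) \<Longrightarrow> queries t' = queries t \<Longrightarrow>
      I D t \<Longrightarrow> I D t'"
  shows "I (D \<union> (\<Union>k\<le>n. E k)) (exec n A (with_flips x p) s) \<and> holds w (exec n A (with_flips x p) s)"
proof -
  define q where "q = Seq (flip x) (Seq p (flip x))"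
  define U where "U = unchanged (insert x (written_regs p)) (insert ''u'' (written_arrays p)) s"
  have "I (D \<union> (\<Union>j<nval agents_succ s. E j)) (exec n A (For x agents_succ q) s) \<and>
      holds w (exec n A (For x agents_succ q) s) \<and> U (exec n A (For x agents_succ q) s)"
  proof (rule For_invariant[where I = "\<lambda>k t. I (D \<union> (\<Union>j<k. E j)) t \<and> holds w t \<and> U t"])
    have "I D (tick 1 s)" by (rule cong[OF _ _ init]) auto
    then show "I (D \<union> (\<Union>j<0. E j)) (tick 1 s) \<and> holds w (tick 1 s) \<and> U (tick 1 s)"
      using w by (simp add: U_def holds_def unchanged_def)
  next
    fix k t
    assume k: "k < nval agents_succ s"
      and t: "I (D \<union> (\<Union>j<k. E j)) t \<and> holds w t \<and> U t"
    define t0 where "t0 = tick 1 (set_reg x k t)"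
    define t1 where "t1 = exec n A (flip x) t0"
    define t2 where "t2 = exec n A p t1"
    define t3 where "t3 = exec n A (flip x) t2"
    have kn: "k \<le> n" using k w by (simp add: holds_def)
    have h0: "holds w t0" using t x by (simp add: t0_def holds_def)
    have x1: "regs t1 x = k" by (simp add: t1_def t0_def flip_def)
    have h1: "holds (tog w k) t1"
      using holds_flip[OF h0 w(2), of x A] by (simp add: t1_def t0_def)
    have U1: "U t1" using t by (simp add: U_def unchanged_def t1_def t0_def flip_def)
    have I1: "I (D \<union> (\<Union>j<k. E j)) t1"
      by (rule cong[of _ t]) (use t in \<open>auto simp: t1_def t0_def flip_def\<close>)
    have I2: "I (D \<union> (\<Union>j<k. E j) \<union> E k) t2" and h2: "holds (tog w k) t2"
      using step[OF kn U1[unfolded U_def] x1 h1 I1] by (simp_all add: t2_def)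
    \<comment> \<open>The second flip reads the loop register again, so the body must have preserved
      it.\<close>
    have x2: "regs t2 x = k" using x x1 by (simp add: t2_def exec_regs)
    have h3: "holds w t3"
      using holds_flip[OF h2, of x A] w x2 by (simp add: t3_def)
    have "I (D \<union> (\<Union>j<k. E j) \<union> E k) t3"
      by (rule cong[OF _ _ I2]) (auto simp: t3_def flip_def)
    moreover have "U t3"
      using U1 by (auto simp: U_def unchanged_def t3_def t2_def flip_def exec_regs exec_arrays)
    moreover have "exec n A q (tick 1 (set_reg x k t)) = t3"
      by (simp add: q_def t3_def t2_def t1_def t0_def)
    ultimately show "I (D \<union> (\<Union>j<Suc k. E j)) (exec n A q (tick 1 (set_reg x k t))) \<and>
        holds w (exec n A q (tick 1 (set_reg x k t))) \<and> U (exec n A q (tick 1 (set_reg x k t)))"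
      using h3 by (simp add: lessThan_Suc Un_ac)
  qed
  moreover have "(\<Union>j<nval agents_succ s. E j) = (\<Union>j\<le>n. E j)"
    using w(1) by (auto simp: holds_def less_Suc_eq_le)
  ultimately show ?thesis by (simp add: with_flips_def q_def)
qed

lemma holds_unchanged:
  "holds w s \<Longrightarrow> unchanged R B s t \<Longrightarrow> ''n'' \<notin> R \<Longrightarrow> ''l'' \<notin> B \<Longrightarrow> ''h'' \<notin> B \<Longrightarrow> ''u'' \<notin> B \<Longrightarrow> holds w t"
  by (simp add: holds_def unchanged_def)

lemma answered_unchanged:
  "answered v D s \<Longrightarrow> unchanged R B s t \<Longrightarrow> ''y'' \<notin> B \<Longrightarrow> answered v D t"
  by (simp add: answered_def unchanged_def)

lemma exec_ask:
  assumes v: "v \<in> V" and s: "regs s ''n'' = n" "arrays s ''l'' [] = lo" "arrays s ''h'' [] = hi"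
    "\<And>i. i < n \<Longrightarrow> arrays s ''v'' [i] = v ! i" "queries s = []"
  shows "holds v (exec n A ask s)"
    and "answered v ({..n} \<times> triples) (exec n A ask s)"
    and "set (queries (exec n A ask s)) \<subseteq> V"
proof -
  let ?q = "Query ''u'' ''y'' [NVar ''a'', NVar ''b'', NVar ''c'', NVar ''d'']"
  define s0 where "s0 = exec n A (for_agents (Store ''u'' [NVar ''i''] (RArr ''v'' [NVar ''i'']))) s"
  have "arrays s0 ''u'' = (\<lambda>js. if \<exists>k<n. js = [] @ [k] then v ! last js else arrays s ''u'' js)"
    unfolding s0_def
    by (rule exec_for_agents) (use s in \<open>auto simp: unchanged_def\<close>)
  then have h0: "holds v s0"
    using s(1-3) by (simp add: holds_def s0_def exec_regs exec_arrays)
  define I where "I = (\<lambda>D t. answered v D t \<and> set (queries t) \<subseteq> V)"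
  have cong: "I D t'" if "\<And>a. a \<noteq> ''u'' \<Longrightarrow> arrays t' a = arrays t a"
    "queries t' = queries t" "I D t" for D t t'
    using that by (simp add: I_def answered_def)
  have I0: "I {} s0" using s(5) by (simp add: I_def answered_def s0_def exec_queries)
  have len: "length v = n" using v by (rule V_length)
  have "I ({} \<union> (\<Union>a\<le>n. \<Union>b\<le>n. \<Union>c\<le>n. \<Union>d\<le>n. {(a, b, c, d)}))
      (exec n A (with_flips ''a'' (with_flips ''b'' (with_flips ''c'' (with_flips ''d'' ?q)))) s0) \<and>
    holds v (exec n A (with_flips ''a'' (with_flips ''b'' (with_flips ''c'' (with_flips ''d'' ?q)))) s0)"
  \<comment> \<open>One application per toggle; the set collected by an inner loop is the increment
    of the loop around it.\<close>
  proof (rule with_flips_collect[where I = I, OF I0 h0 len _ _ _ cong])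
    fix a Da sa
    assume a: "regs sa ''a'' = a" "holds (tog v a) sa" "I Da sa"
    show "I (Da \<union> (\<Union>b\<le>n. \<Union>c\<le>n. \<Union>d\<le>n. {(a, b, c, d)}))
        (exec n A (with_flips ''b'' (with_flips ''c'' (with_flips ''d'' ?q))) sa) \<and>
      holds (tog v a) (exec n A (with_flips ''b'' (with_flips ''c'' (with_flips ''d'' ?q))) sa)"
    proof (rule with_flips_collect[where I = I, OF a(3,2) _ _ _ _ cong])
      fix b Db sb
      assume ub: "unchanged (insert ''b'' (written_regs (with_flips ''c'' (with_flips ''d'' ?q))))
          (insert ''u'' (written_arrays (with_flips ''c'' (with_flips ''d'' ?q)))) sa sb"
        and b: "regs sb ''b'' = b" "holds (tog (tog v a) b) sb" "I Db sb"
      have ab: "regs sb ''a'' = a" using ub a by (simp add: unchanged_def with_flips_def flip_def)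
      show "I (Db \<union> (\<Union>c\<le>n. \<Union>d\<le>n. {(a, b, c, d)}))
          (exec n A (with_flips ''c'' (with_flips ''d'' ?q)) sb) \<and>
        holds (tog (tog v a) b) (exec n A (with_flips ''c'' (with_flips ''d'' ?q)) sb)"
      proof (rule with_flips_collect[where I = I, OF b(3,2) _ _ _ _ cong])
        fix c Dc sc
        assume uc: "unchanged (insert ''c'' (written_regs (with_flips ''d'' ?q)))
            (insert ''u'' (written_arrays (with_flips ''d'' ?q))) sb sc"
          and c: "regs sc ''c'' = c" "holds (tog (tog (tog v a) b) c) sc" "I Dc sc"
        have abc: "regs sc ''a'' = a" "regs sc ''b'' = b"
          using uc ab b by (simp_all add: unchanged_def with_flips_def flip_def)
        show "I (Dc \<union> (\<Union>d\<le>n. {(a, b, c, d)})) (exec n A (with_flips ''d'' ?q) sc) \<and>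
          holds (tog (tog (tog v a) b) c) (exec n A (with_flips ''d'' ?q) sc)"
        proof (rule with_flips_collect[where I = I, OF c(3,2) _ _ _ _ cong])
          fix d Dd sd
          assume ud: "unchanged (insert ''d'' (written_regs ?q)) (insert ''u'' (written_arrays ?q)) sc sd"
            and d: "regs sd ''d'' = d" "holds (tog (tog (tog (tog v a) b) c) d) sd" "I Dd sd"
          have abcd: "regs sd ''a'' = a" "regs sd ''b'' = b" "regs sd ''c'' = c"
            using ud abc c by (simp_all add: unchanged_def)
          let ?w = "tog (tog (tog (tog v a) b) c) d"
          have "get_vector n ''u'' sd = ?w"
            using d(2) len by (intro nth_equalityI) (auto simp: get_vector_def holds_def)
          then show "I (Dd \<union> {(a, b, c, d)}) (exec n A ?q sd) \<and> holds ?w (exec n A ?q sd)"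
            using d abcd v by (auto simp: I_def answered_def holds_def)
        qed (auto simp: len)
      qed (auto simp: len with_flips_def flip_def)
    qed (auto simp: len with_flips_def flip_def)
  qed (auto simp: len with_flips_def flip_def)
  moreover have "(\<Union>a\<le>n. \<Union>b\<le>n. \<Union>c\<le>n. \<Union>d\<le>n. {(a, b, c, d)}) = {..n} \<times> triples"
    by (auto simp: triples_def)
  ultimately show "holds v (exec n A ask s)"
    and "answered v ({..n} \<times> triples) (exec n A ask s)"
    and "set (queries (exec n A ask s)) \<subseteq> V"
    by (simp_all add: ask_def I_def s0_def)
qed

section \<open>Computing the preliminary allocations\<close>

lemma rval_high: "holds w t \<Longrightarrow> regs t ''i'' < n \<Longrightarrow> rval high_exp t = chi w (regs t ''i'')"
  by (simp add: holds_def high_exp_def high_def)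

lemma rval_low: "holds w t \<Longrightarrow> regs t ''i'' < n \<Longrightarrow> rval low_exp t = 1 - chi w (regs t ''i'')"
  by (simp add: low_exp_def rval_high)

lemma rval_answer:
  assumes "answered v ({..n} \<times> triples) t" "map (\<lambda>e. nval e t) es = [a, b, c, d]"
    "a \<le> n" "b \<le> n" "c \<le> n" "d \<le> n" "regs t ''i'' < n"
  shows "rval (answer es) t = A (tog (tog (tog (tog v a) b) c) d) ! regs t ''i''"
  using assms by (auto simp: answer_def answered_def triples_def)

text \<open>The clause of \<open>preliminary\<close> for vectors that are not needy, with a running
  maximum \<open>m\<close> in place of \<open>best_high\<close>.\<close>

definition attained :: "real list \<Rightarrow> real \<Rightarrow> (nat list \<Rightarrow> real) \<Rightarrow> bool" where
  "attained w m p \<longleftrightarrow> m = 0 \<and> (\<forall>i<n. p [i] = 0) \<or>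
     (\<exists>b\<le>n. \<exists>c\<le>n. \<exists>d\<le>n. m = high_value w (b, c, d) \<and>
        (\<forall>i<n. p [i] = chi w i * A (tog (tog (tog w b) c) d) ! i))"

text \<open>The state of the search once the triples in \<open>D\<close> have been examined; for
  \<open>D = triples\<close> the maximum is \<open>best_high w\<close>.\<close>

definition found :: "real list \<Rightarrow> (nat \<times> nat \<times> nat) set \<Rightarrow> machine \<Rightarrow> bool" where
  "found w D t \<longleftrightarrow> D \<subseteq> triples \<and> arrays t ''m'' [] = Max (insert 0 (high_value w ` D)) \<and>
     attained w (Max (insert 0 (high_value w ` D))) (arrays t ''p'')"

lemma exec_search_high:
  assumes s: "holds (tog v a) s" "answered v ({..n} \<times> triples) s" "regs s ''a'' = a" "a \<le> n"
  shows "found (tog v a) triples (exec n A search_high s)"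
proof -
  let ?w = "tog v a"
  let ?y = "RTimes high_exp (answer [NVar ''a'', NVar ''b'', NVar ''c'', NVar ''d''])"
  let ?z = "RTimes (RArr ''h'' []) (RArr ''s'' [])"
  define test where "test = Cond (RLess (RArr ''m'' []) ?z)
    (Seq (Store ''m'' [] ?z) (for_agents (Store ''p'' [NVar ''i''] ?y))) skip"
  define body where "body = Seq (total ?y) test"
  define s1 where "s1 = exec n A (Store ''m'' [] (RConst 0)) s"
  define s0 where "s0 = exec n A (for_agents (Store ''p'' [NVar ''i''] (RConst 0))) s1"
  let ?U = "unchanged {''b'', ''c'', ''d'', ''i'', ''z''} {''m'', ''p'', ''s''} s"
  have eval: "rval ?y t = chi ?w k * A (tog (tog (tog ?w b) c) d) ! k"
    if "?U t" "regs t ''b'' = b" "regs t ''c'' = c" "regs t ''d'' = d" "regs t ''i'' = k"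
      "b \<le> n" "c \<le> n" "d \<le> n" "k < n" for t b c d k
  proof -
    have "holds ?w t" using s(1) that(1) by (rule holds_unchanged) auto
    moreover have "answered v ({..n} \<times> triples) t"
      using s(2) that(1) by (rule answered_unchanged) auto
    moreover have "regs t ''a'' = a" using that(1) s(3) by (simp add: unchanged_def)
    ultimately show ?thesis
      using that s(4) by (simp add: rval_high rval_answer[where a = a and b = b and c = c and d = d])
  qed
  have body: "found ?w (D \<union> {(b, c, d)}) (exec n A body t)"
    if t: "?U t" "found ?w D t" "regs t ''b'' = b" "regs t ''c'' = c" "regs t ''d'' = d"
      and bcd: "b \<le> n" "c \<le> n" "d \<le> n" for t D b c d
  proof -
    define t1 where "t1 = exec n A (total ?y) t"
    let ?q = "tog (tog (tog ?w b) c) d"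
    have n: "regs t ''n'' = n" using t(1) s(1) by (simp add: unchanged_def holds_def)
    have yt: "rval ?y t' = chi ?w k * A ?q ! k"
      if "k < n" "unchanged {''i''} {''s''} t t'" "regs t' ''i'' = k" for k t'
      by (rule eval) (use that t bcd in \<open>auto simp: unchanged_def\<close>)
    have sum: "arrays t1 ''s'' [] = high_sum ?w (A ?q)"
      and U1: "unchanged {''i''} {''s''} t t1"
      using exec_total[OF n yt, where A = A] by (simp_all add: t1_def high_sum_def)
    have m: "arrays t1 ''m'' [] = arrays t ''m'' []" and p: "arrays t1 ''p'' = arrays t ''p''"
      using U1 by (simp_all add: unchanged_def)
    have h: "arrays t1 ''h'' [] = hi"
      using U1 t(1) s(1) by (simp add: unchanged_def holds_def)
    have z: "rval ?z t1 = high_value ?w (b, c, d)" using sum h by (simp add: high_value_def)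
    have fin: "finite D" using t(2) finite_subset[OF _ finite_triples] by (auto simp: found_def)
    have Max: "Max (insert 0 (high_value ?w ` (D \<union> {(b, c, d)}))) =
        max (high_value ?w (b, c, d)) (Max (insert 0 (high_value ?w ` D)))"
      using fin by (simp add: insert_commute Max_insert[symmetric] del: Max_insert)
    have mem: "(b, c, d) \<in> triples" using bcd by (simp add: triples_def)
    show ?thesis
    proof (cases "arrays t ''m'' [] < high_value ?w (b, c, d)")
      case False
      then have "exec n A body t = exec n A skip (tick 1 t1)"
        using z m by (simp add: body_def test_def t1_def)
      then have same: "arrays (exec n A body t) ''m'' [] = arrays t ''m'' []"
        "arrays (exec n A body t) ''p'' = arrays t ''p''"
        using m p by simp_all
      have "Max (insert 0 (high_value ?w ` (D \<union> {(b, c, d)}))) = Max (insert 0 (high_value ?w ` D))"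
        unfolding Max using t(2) False by (simp add: found_def)
      then show ?thesis
        using t(2) mem unfolding found_def same by simp
    next
      case True
      define t2 where "t2 = exec n A (Store ''m'' [] ?z) (tick 1 t1)"
      define t3 where "t3 = exec n A (for_agents (Store ''p'' [NVar ''i''] ?y)) t2"
      have t3: "exec n A body t = t3"
        using z m True by (simp add: body_def test_def t1_def t2_def t3_def)
      have n2: "regs t2 ''n'' = n" using n U1 by (simp add: t2_def unchanged_def)
      have ys: "arrays (exec n A (Store ''p'' [NVar ''i''] ?y) t') ''p'' =
          (arrays t' ''p'')([] @ [k] := chi ?w k * A ?q ! k)"
        if "k < n" "unchanged {''i''} {''p''} t2 t'" "regs t' ''i'' = k" for k t'
      proof -
        have "rval ?y t' = chi ?w k * A ?q ! k"
          by (rule eval) (use that t bcd U1 in \<open>auto simp: unchanged_def t2_def\<close>)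
        then show ?thesis using that(3) by simp
      qed
      have p3: "arrays t3 ''p'' = (\<lambda>js. if \<exists>k<n. js = [] @ [k]
          then chi ?w (last js) * A ?q ! last js else arrays t2 ''p'' js)"
        and U3: "unchanged {''i''} {''p''} t2 t3"
        unfolding t3_def
        by (rule exec_for_agents[where pre = "[]" and f = "\<lambda>k. chi ?w k * A ?q ! k",
              OF n2 _ _ ys]; simp)+
      have Max': "Max (insert 0 (high_value ?w ` (D \<union> {(b, c, d)}))) = high_value ?w (b, c, d)"
        unfolding Max using t(2) True by (simp add: found_def)
      have "arrays t2 ''m'' [] = high_value ?w (b, c, d)" using z by (simp add: t2_def)
      then have "arrays t3 ''m'' [] = high_value ?w (b, c, d)" using U3 by (simp add: unchanged_def)
      moreover have "attained ?w (high_value ?w (b, c, d)) (arrays t3 ''p'')"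
        unfolding attained_def by (rule disjI2) (use bcd p3 in auto)
      ultimately show ?thesis
        using t(2) mem unfolding t3 found_def Max' by simp
    qed
  qed
  have n1: "regs s1 ''n'' = n" using s(1) by (simp add: s1_def holds_def)
  have "arrays s0 ''p'' = (\<lambda>js. if \<exists>k<n. js = [] @ [k] then 0 else arrays s1 ''p'' js)"
    "unchanged {''i''} {''p''} s1 s0"
    unfolding s0_def by (rule exec_for_agents[where pre = "[]" and f = "\<lambda>_. 0", OF n1]; simp)+
  then have f0: "found ?w {} s0" and U0: "?U s0"
    by (auto simp: found_def attained_def s1_def unchanged_def)
  have cong: "found ?w D t'" if "arrays t' = arrays t" "found ?w D t" for D t t'
    using that by (simp add: found_def)
  have wb: "written_regs body = {''i'', ''z''}" "written_arrays body = {''m'', ''p'', ''s''}"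
    by (auto simp: body_def test_def total_def)
  \<comment> \<open>The bounds of the inner loops are evaluated in states reached by the outer ones,
    so the frame condition has to be followed through all levels.\<close>
  have Un: "nval agents_succ t = n + 1" if "?U t" for t
    using that s(1) by (simp add: unchanged_def holds_def)
  have "found ?w ({} \<union> (\<Union>b<nval agents_succ s0. \<Union>c<n + 1. \<Union>d<n + 1. {(b, c, d)}))
    (exec n A (For ''b'' agents_succ (For ''c'' agents_succ (For ''d'' agents_succ body))) s0)"
  proof (rule For_collect[where I = "found ?w", OF f0 _ cong])
    fix b D t
    assume b: "b < nval agents_succ s0" "regs t ''b'' = b" "found ?w D t"
      and "unchanged (insert ''b'' (written_regs (For ''c'' agents_succ (For ''d'' agents_succ body))))
        (written_arrays (For ''c'' agents_succ (For ''d'' agents_succ body))) s0 t"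
    then have Ub: "?U t" using wb by (intro unchanged_trans[OF U0]) auto
    have "found ?w (D \<union> (\<Union>c<nval agents_succ t. \<Union>d<n + 1. {(b, c, d)}))
      (exec n A (For ''c'' agents_succ (For ''d'' agents_succ body)) t)"
    proof (rule For_collect[where I = "found ?w", OF b(3) _ cong])
      fix c Dc tc
      assume c: "c < nval agents_succ t" "regs tc ''c'' = c" "found ?w Dc tc"
        and uc: "unchanged (insert ''c'' (written_regs (For ''d'' agents_succ body)))
          (written_arrays (For ''d'' agents_succ body)) t tc"
      then have Uc: "?U tc" using wb by (intro unchanged_trans[OF Ub]) auto
      have bc: "regs tc ''b'' = b" using uc b by (simp add: unchanged_def wb)
      have "found ?w (Dc \<union> (\<Union>d<nval agents_succ tc. {(b, c, d)}))
        (exec n A (For ''d'' agents_succ body) tc)"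
      proof (rule For_collect[where I = "found ?w", OF c(3) _ cong])
        fix d Dd td
        assume d: "d < nval agents_succ tc" "regs td ''d'' = d" "found ?w Dd td"
          and ud: "unchanged (insert ''d'' (written_regs body)) (written_arrays body) tc td"
        then have "?U td" using wb by (intro unchanged_trans[OF Uc]) auto
        moreover have "regs td ''b'' = b" "regs td ''c'' = c"
          using ud bc c by (simp_all add: unchanged_def wb)
        ultimately show "found ?w (Dd \<union> {(b, c, d)}) (exec n A body td)"
          using d b c Un[OF U0] Un[OF Ub] Un[OF Uc] by (intro body) auto
      qed
      then show "found ?w (Dc \<union> (\<Union>d<n + 1. {(b, c, d)})) (exec n A (For ''d'' agents_succ body) tc)"
        unfolding Un[OF Uc] .
    qed
    then show "found ?w (D \<union> (\<Union>c<n + 1. \<Union>d<n + 1. {(b, c, d)}))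
      (exec n A (For ''c'' agents_succ (For ''d'' agents_succ body)) t)"
      unfolding Un[OF Ub] .
  qed
  moreover have "(\<Union>b<n + 1. \<Union>c<n + 1. \<Union>d<n + 1. {(b, c, d)}) = triples"
    by (auto simp: triples_def)
  ultimately show ?thesis
    unfolding Un[OF U0] by (simp add: search_high_def Let_def body_def test_def s0_def s1_def)
qed

lemma exec_search_low:
  assumes v: "v \<in> V" and s: "holds (tog v a) s" "answered v ({..n} \<times> triples) s"
    "regs s ''a'' = a" "a \<le> n"
  shows "regs (exec n A search_low s) ''k'' = source (tog v a)"
    and "arrays (exec n A search_low s) ''g'' [] = low_value (tog v a) (source (tog v a))"
proof -
  let ?w = "tog v a"
  let ?f = "low_value ?w"
  let ?U = "unchanged {''b'', ''i'', ''k'', ''z''} {''g'', ''s''} s"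
  let ?y = "RTimes low_exp (answer [NVar ''a'', NVar ''b'', agents, agents])"
  define body where "body = Seq (total ?y)
    (Cond (RLess (RArr ''g'' []) (RArr ''s'' []))
       (Seq (Assign ''k'' (NVar ''b'')) (Store ''g'' [] (RArr ''s'' []))) skip)"
  define s0 where "s0 = exec n A (Seq (Assign ''k'' (NConst 0)) (Store ''g'' [] (RConst 0))) s"
  have len: "length v = n" using v by (rule V_length)
  have pos: "0 \<le> ?f b" for b
    unfolding low_value_def using v by (intro low_sum_nonneg) auto
  have eval: "rval ?y t = (1 - chi ?w k) * A (tog ?w b) ! k"
    if "?U t" "regs t ''b'' = b" "regs t ''i'' = k" "b \<le> n" "k < n" for t b k
  proof -
    have "holds ?w t" using s(1) that(1) by (rule holds_unchanged) auto
    moreover have "answered v ({..n} \<times> triples) t"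
      using s(2) that(1) by (rule answered_unchanged) auto
    moreover have "regs t ''a'' = a" "regs t ''n'' = n"
      using that(1) s(1,3) by (simp_all add: unchanged_def holds_def)
    ultimately show ?thesis
      using that s(4) len
      by (simp add: rval_low rval_answer[where a = a and b = b and c = n and d = n])
  qed
  have U0: "?U s0" by (simp add: s0_def unchanged_def)
  have n0: "nval agents_succ s0 = n + 1" using s(1) by (simp add: s0_def holds_def)
  have "?U (exec n A (For ''b'' agents_succ body) s0) \<and>
      regs (exec n A (For ''b'' agents_succ body) s0) ''k'' = best_index ?f (nval agents_succ s0) \<and>
      arrays (exec n A (For ''b'' agents_succ body) s0) ''g'' [] =
        (if nval agents_succ s0 = 0 then 0 else ?f (best_index ?f (nval agents_succ s0)))"
  \<comment> \<open>Before the first round \<open>g\<close> is 0 and not yet a low value. The first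
    round repairs this even if its test fails: low values are nonnegative, so failure means that
    \<open>?f 0\<close> is 0.\<close>
  proof (rule For_invariant[where I = "\<lambda>k t. ?U t \<and> regs t ''k'' = best_index ?f k \<and>
        arrays t ''g'' [] = (if k = 0 then 0 else ?f (best_index ?f k))"])
    fix b t
    assume b: "b < nval agents_succ s0"
      and t: "?U t \<and> regs t ''k'' = best_index ?f b \<and>
        arrays t ''g'' [] = (if b = 0 then 0 else ?f (best_index ?f b))"
    define t0 where "t0 = tick 1 (set_reg ''b'' b t)"
    define t1 where "t1 = exec n A (total ?y) t0"
    have U: "?U t0" using t by (simp add: t0_def unchanged_def)
    have n: "regs t0 ''n'' = n" using U s(1) by (simp add: unchanged_def holds_def)
    have yt: "rval ?y t' = (1 - chi ?w k) * A (tog ?w b) ! k"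
      if "k < n" "unchanged {''i''} {''s''} t0 t'" "regs t' ''i'' = k" for k t'
      by (rule eval) (use that U b n0 in \<open>auto simp: unchanged_def t0_def\<close>)
    have sum: "arrays t1 ''s'' [] = ?f b" and U1: "unchanged {''i''} {''s''} t0 t1"
      using exec_total[OF n yt, where A = A] by (simp_all add: t1_def low_value_def low_sum_def)
    have k1: "regs t1 ''k'' = best_index ?f b" "regs t1 ''b'' = b"
      "arrays t1 ''g'' [] = (if b = 0 then 0 else ?f (best_index ?f b))"
      using U1 t by (simp_all add: unchanged_def t0_def)
    have U2: "?U t1" using U1 U by (auto simp: unchanged_def)
    have e: "exec n A body t0 = (if arrays t1 ''g'' [] < ?f b
        then tick 1 (set_cell ''g'' [] (?f b) (tick 1 (set_reg ''k'' b (tick 1 t1))))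
        else tick 1 (set_reg ''z'' 0 (tick 1 t1)))"
      using sum k1 by (simp add: body_def t1_def[symmetric])
    show "?U (exec n A body (tick 1 (set_reg ''b'' b t))) \<and>
        regs (exec n A body (tick 1 (set_reg ''b'' b t))) ''k'' = best_index ?f (Suc b) \<and>
        arrays (exec n A body (tick 1 (set_reg ''b'' b t))) ''g'' [] =
          (if Suc b = 0 then 0 else ?f (best_index ?f (Suc b)))"
      unfolding t0_def[symmetric] e using U2 k1 pos[of 0]
      by (cases "b = 0") (auto simp: unchanged_def)
  qed (simp add: s0_def unchanged_def)
  then show "regs (exec n A search_low s) ''k'' = source ?w"
    "arrays (exec n A search_low s) ''g'' [] = ?f (source ?w)"
    unfolding n0 by (simp_all add: source_def search_low_def body_def s0_def)
qed

lemma exec_serve_low: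
  assumes v: "v \<in> V" and s: "holds (tog v a) s" "answered v ({..n} \<times> triples) s"
    "regs s ''a'' = a" "a \<le> n"
    and q: "real_of_rat q = \<kappa>"
    and k: "regs s ''k'' = source (tog v a)"
    and g: "arrays s ''g'' [] = low_value (tog v a) (source (tog v a))"
    and f: "found (tog v a) triples s"
  shows "preliminary (tog v a) (\<lambda>i. arrays (exec n A (serve_low q) s) ''p'' [i])"
proof -
  let ?w = "tog v a"
  let ?b = "source ?w"
  let ?y = "RTimes low_exp (answer [NVar ''a'', NVar ''k'', agents, agents])"
  let ?y' = "RTimes low_exp (answer [NVar ''a'', agents, agents, agents])"
  let ?U = "unchanged {''i''} {''c'', ''s''} s"
  define put where "put = Cond (RLess (RTimes (RTimes (RConst 2) (RArr ''c'' [])) ?y) (RArr ''g'' []))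
    (Store ''p'' [NVar ''i''] (RConst 0)) (Store ''p'' [NVar ''i''] ?y)"
  define s1 where "s1 = exec n A (Seq (total (RConst 1)) (Store ''c'' [] (RArr ''s'' []))) s"
  define s2 where "s2 = exec n A (total ?y') s1"
  have len: "length v = n" using v by (rule V_length)
  have eval: "rval ?y t = (1 - chi ?w i) * A (tog ?w ?b) ! i"
    "rval ?y' t = (1 - chi ?w i) * A ?w ! i"
    if "unchanged {''i''} {''c'', ''s'', ''p''} s t" "regs t ''i'' = i" "i < n" for t i
  proof -
    have "holds ?w t" using s(1) that(1) by (rule holds_unchanged) auto
    moreover have "answered v ({..n} \<times> triples) t"
      using s(2) that(1) by (rule answered_unchanged) auto
    moreover have "regs t ''a'' = a" "regs t ''n'' = n" "regs t ''k'' = ?b"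
      using that(1) s(1,3) k by (simp_all add: unchanged_def holds_def)
    ultimately show "rval ?y t = (1 - chi ?w i) * A (tog ?w ?b) ! i"
      "rval ?y' t = (1 - chi ?w i) * A ?w ! i"
      using that s(4) len source_le[of ?w]
      by (simp_all add: rval_low rval_answer[where a = a and b = ?b and c = n and d = n]
          rval_answer[where a = a and b = n and c = n and d = n])
  qed
  have n: "regs s ''n'' = n" using s(1) by (simp add: holds_def)
  have "arrays (exec n A (total (RConst 1)) s) ''s'' [] = (\<Sum>i<n. 1)"
    "unchanged {''i''} {''s''} s (exec n A (total (RConst 1)) s)"
    by (rule exec_total[OF n]; simp)+
  then have c1: "arrays s1 ''c'' [] = real n" and U1: "?U s1"
    by (simp_all add: s1_def unchanged_def)
  have n1: "regs s1 ''n'' = n" using U1 n by (simp add: unchanged_def)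
  have "rval ?y' t = (1 - chi ?w i) * A ?w ! i"
    if "i < n" "unchanged {''i''} {''s''} s1 t" "regs t ''i'' = i" for i t
    by (rule eval) (use that U1 in \<open>auto simp: unchanged_def\<close>)
  from exec_total[OF n1 this, where A = A]
  have s2: "arrays s2 ''s'' [] = low_sum ?w (A ?w)" and U12: "unchanged {''i''} {''s''} s1 s2"
    by (simp_all add: s2_def low_sum_def)
  have U2: "?U s2" using U12 U1 by (auto simp: unchanged_def)
  have c2: "arrays s2 ''c'' [] = real n" using U12 c1 by (simp add: unchanged_def)
  have m2: "arrays s2 ''m'' [] = best_high ?w"
    using U2 f by (simp add: unchanged_def found_def best_high_def)
  have p2: "attained ?w (best_high ?w) (arrays s2 ''p'')"
    using U2 f by (simp add: unchanged_def found_def best_high_def)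
  have l2: "arrays s2 ''l'' [] = lo" using U2 s(1) by (simp add: unchanged_def holds_def)
  \<comment> \<open>The test made by the program is the definition of \<open>needy\<close>:
    \<open>m\<close> holds \<open>best_high\<close>, \<open>s\<close> the low sum, and
    \<open>q\<close> is \<open>\<kappa>\<close>.\<close>
  have e: "exec n A (serve_low q) s =
      (if needy ?w then exec n A (for_agents put) (tick 1 s2) else exec n A skip (tick 1 s2))"
    using s2 m2 l2 q
    by (simp add: serve_low_def Let_def needy_def put_def s2_def s1_def del: exec.simps(1))
  show ?thesis
  proof (cases "needy ?w")
    case True
    have n3: "regs (tick 1 s2) ''n'' = n" using U2 n by (simp add: unchanged_def)
    have ps: "arrays (exec n A put t) ''p'' = (arrays t ''p'')([] @ [i] := low_alloc ?w i)"
      if i: "i < n" and t: "unchanged {''i''} {''p''} (tick 1 s2) t" "regs t ''i'' = i" for i t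
    proof -
      have "rval ?y t = (1 - chi ?w i) * A (tog ?w ?b) ! i"
        "rval ?y (tick 1 t) = (1 - chi ?w i) * A (tog ?w ?b) ! i"
        by (rule eval; use i t U2 in \<open>simp add: unchanged_def\<close>)+
      moreover have "arrays t ''c'' [] = real n" "arrays t ''g'' [] = low_value ?w ?b"
        using t(1) U2 c2 g by (simp_all add: unchanged_def)
      ultimately show ?thesis
        using t(2) by (simp add: put_def low_alloc_def Let_def mult.assoc)
    qed
    have "arrays (exec n A (for_agents put) (tick 1 s2)) ''p'' =
        (\<lambda>js. if \<exists>i<n. js = [] @ [i] then low_alloc ?w (last js) else arrays (tick 1 s2) ''p'' js)"
      by (rule exec_for_agents[where pre = "[]" and f = "low_alloc ?w", OF n3 _ _ ps]) (simp_all add: put_def)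
    then show ?thesis using True by (simp add: e preliminary_def)
  next
    case False
    then show ?thesis using p2 by (simp add: e preliminary_def attained_def)
  qed
qed

lemma exec_prepare:
  assumes v: "v \<in> V" and s: "holds v s" "answered v ({..n} \<times> triples) s"
    and q: "real_of_rat q = \<kappa>"
  shows "\<forall>a\<le>n. preliminary (tog v a) (\<lambda>i. arrays (exec n A (prepare q) s) ''r'' [a, i])"
proof -
  define copy where
    "copy = for_agents (Store ''r'' [NVar ''a'', NVar ''i''] (RArr ''p'' [NVar ''i'']))"
  define body where "body = Seq search_high (Seq search_low (Seq (serve_low q) copy))"
  define I where "I = (\<lambda>D t. answered v ({..n} \<times> triples) t \<and>
    (\<forall>a\<in>D. preliminary (tog v a) (\<lambda>i. arrays t ''r'' [a, i])))"
  have I0: "I {} s" using s(2) by (simp add: I_def)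
  have cong: "I D t'" if "\<And>a. a \<noteq> ''u'' \<Longrightarrow> arrays t' a = arrays t a"
    "queries t' = queries t" "I D t" for D t t'
    using that by (simp add: I_def answered_def)
  have "I ({} \<union> (\<Union>a\<le>n. {a})) (exec n A (with_flips ''a'' body) s) \<and>
    holds v (exec n A (with_flips ''a'' body) s)"
  proof (rule with_flips_collect[where I = I, OF I0 s(1) V_length[OF v] _ _ _ cong])
    fix a D t
    assume a: "a \<le> n" "regs t ''a'' = a" and h: "holds (tog v a) t" and It: "I D t"
    let ?w = "tog v a"
    define t1 where "t1 = exec n A search_high t"
    define t2 where "t2 = exec n A search_low t1"
    define t3 where "t3 = exec n A (serve_low q) t2"
    define t4 where "t4 = exec n A copy t3"
    note defs = search_high_def search_low_def serve_low_def total_def Let_def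
    have y: "answered v ({..n} \<times> triples) t" using It by (simp add: I_def)
    have F1: "found ?w triples t1"
      unfolding t1_def by (rule exec_search_high[OF h y a(2,1)])
    have U1: "unchanged {''b'', ''c'', ''d'', ''i'', ''z''} {''m'', ''p'', ''s''} t t1"
      by (auto simp: unchanged_def t1_def defs exec_regs exec_arrays)
    have h1: "holds ?w t1" by (rule holds_unchanged[OF h U1]) auto
    have y1: "answered v ({..n} \<times> triples) t1" by (rule answered_unchanged[OF y U1]) auto
    have a1: "regs t1 ''a'' = a" using U1 a by (simp add: unchanged_def)
    have K2: "regs t2 ''k'' = source ?w" "arrays t2 ''g'' [] = low_value ?w (source ?w)"
      unfolding t2_def by (rule exec_search_low[OF v h1 y1 a1 a(1)])+
    have U2: "unchanged {''b'', ''i'', ''k'', ''z''} {''g'', ''s''} t1 t2"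
      by (auto simp: unchanged_def t2_def defs exec_regs exec_arrays)
    have h2: "holds ?w t2" by (rule holds_unchanged[OF h1 U2]) auto
    have y2: "answered v ({..n} \<times> triples) t2" by (rule answered_unchanged[OF y1 U2]) auto
    have a2: "regs t2 ''a'' = a" using U2 a1 by (simp add: unchanged_def)
    have F2: "found ?w triples t2" using F1 U2 by (simp add: found_def unchanged_def)
    have P3: "preliminary ?w (\<lambda>i. arrays t3 ''p'' [i])"
      unfolding t3_def by (rule exec_serve_low[OF v h2 y2 a2 a(1) q K2 F2])
    have U3: "unchanged {''i'', ''z''} {''c'', ''p'', ''s''} t2 t3"
      by (auto simp: unchanged_def t3_def defs exec_regs exec_arrays)
    have h3: "holds ?w t3" by (rule holds_unchanged[OF h2 U3]) auto
    have y3: "answered v ({..n} \<times> triples) t3" by (rule answered_unchanged[OF y2 U3]) auto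
    have a3: "regs t3 ''a'' = a" using U3 a2 by (simp add: unchanged_def)
    have n3: "regs t3 ''n'' = n" using h3 by (simp add: holds_def)
    have r: "arrays t4 ''r'' =
        (\<lambda>js. if \<exists>i<n. js = [a] @ [i] then arrays t3 ''p'' [last js] else arrays t3 ''r'' js)"
      "unchanged {''i''} {''r''} t3 t4"
      unfolding t4_def copy_def
      by (rule exec_for_agents[where pre = "[a]" and f = "\<lambda>k. arrays t3 ''p'' [k]", OF n3];
          use a3 in \<open>simp add: unchanged_def\<close>)+
    have h4: "holds ?w t4" by (rule holds_unchanged[OF h3 r(2)]) auto
    have y4: "answered v ({..n} \<times> triples) t4" by (rule answered_unchanged[OF y3 r(2)]) auto
    have r3: "arrays t3 ''r'' = arrays t ''r''" using U1 U2 U3 by (simp add: unchanged_def)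
    have "preliminary ?w (\<lambda>i. arrays t4 ''r'' [a, i])"
      using P3 by (simp add: preliminary_def r(1))
    \<comment> \<open>Round \<open>a\<close> writes row \<open>a\<close> only, so the rows finished
      earlier survive.\<close>
    moreover have "preliminary (tog v b) (\<lambda>i. arrays t4 ''r'' [b, i])" if "b \<in> D" "b \<noteq> a" for b
      using It that by (simp add: r(1) r3 I_def)
    ultimately have "I (D \<union> {a}) t4" using y4 by (auto simp: I_def)
    moreover have "exec n A body t = t4" by (simp add: body_def t4_def t3_def t2_def t1_def)
    ultimately show "I (D \<union> {a}) (exec n A body t) \<and> holds ?w (exec n A body t)"
      using h4 by simp
  qed (simp_all add: body_def copy_def search_high_def search_low_def serve_low_def total_def Let_def)
  then show ?thesis by (auto simp: I_def prepare_def body_def copy_def)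
qed

section \<open>Meeting the demands\<close>

lemma demand_iff:
  assumes v: "v \<in> V" and r: "preliminary (tog v a) r" and a: "a < n"
  shows "demand v a \<longleftrightarrow> lo < v ! a \<and> 0 < r a"
proof (cases "v ! a = hi")
  case True
  then have "tog v a ! a = lo" using a v by (simp add: tog_nth V_length)
  \<comment> \<open>If the neighbour is not needy, this factor makes the entry of \<open>a\<close>
    zero; a positive entry therefore reveals neediness.\<close>
  then have "chi (tog v a) a = 0" by (rule chi_lo)
  then show ?thesis
    using r a True lo_less_hi by (auto simp: demand_def preliminary_def split: if_splits)
next
  case False
  then show ?thesis using V_nth[OF v a] by (auto simp: demand_def)
qed

lemma demand_amount: "demand v a \<Longrightarrow> preliminary (tog v a) r \<Longrightarrow> r a = low_alloc (tog v a) a"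
  by (simp add: demand_def preliminary_def)

lemma exec_decide:
  assumes v: "v \<in> V" and n: "regs s ''n'' = n" "arrays s ''l'' [] = lo"
    "\<And>i. i < n \<Longrightarrow> arrays s ''v'' [i] = v ! i"
    and y: "answered v ({..n} \<times> triples) s"
    and r: "\<forall>a\<le>n. preliminary (tog v a) (\<lambda>i. arrays s ''r'' [a, i])"
  shows "outcome v (\<lambda>i. arrays (exec n A decide s) ''x'' [i])"
proof -
  define serve where "serve = Seq (for_agents (Store ''x'' [NVar ''i''] (RConst 0)))
    (Seq (Store ''x'' [NVar ''a''] (RArr ''r'' [NVar ''a'', NVar ''a'']))
      (Cond (RLess (RArr ''x'' [NVar ''a''])
          (RArr ''y'' [agents, agents, agents, agents, NVar ''a'']))
        (Store ''x'' [NVar ''a'']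
          (RArr ''y'' [agents, agents, agents, agents, NVar ''a'']))
        skip))"
  define body where "body = Cond (BAnd (RLess (RArr ''l'' []) (RArr ''v'' [NVar ''a'']))
    (RLess (RConst 0) (RArr ''r'' [NVar ''a'', NVar ''a'']))) serve skip"
  define s0 where
    "s0 = exec n A (for_agents (Store ''x'' [NVar ''i''] (RArr ''r'' [agents, NVar ''i'']))) s"
  let ?single = "\<lambda>k i. if i = k then max (low_alloc (tog v k) k) (A v ! k) else 0"
  let ?U = "unchanged {''a'', ''i'', ''z''} {''x''} s"
  \<comment> \<open>The program lets a later demand overwrite an earlier one. Since
    \<open>outcome\<close> accepts any demand, it suffices to record that the agent served has
    one.\<close>
  define J where "J = (\<lambda>m (t :: machine). if \<exists>k<m. demand v k
    then \<exists>k. demand v k \<and> (\<forall>i<n. arrays t ''x'' [i] = ?single k i)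
    else \<forall>i<n. arrays t ''x'' [i] = arrays s ''r'' [n, i])"
  have len: "length v = n" using v by (rule V_length)
  have yn: "arrays s ''y'' [n, n, n, n, i] = A v ! i" if "i < n" for i
    using y that len by (auto simp: answered_def triples_def)
  have x0: "arrays s0 ''x'' =
      (\<lambda>js. if \<exists>i<n. js = [] @ [i] then arrays s ''r'' [n, last js] else arrays s ''x'' js)"
    "unchanged {''i''} {''x''} s s0"
    unfolding s0_def by (rule exec_for_agents[where pre = "[]" and f = "\<lambda>k. arrays s ''r'' [n, k]", OF n(1)];
        use n(1) in \<open>simp add: unchanged_def\<close>)+
  have "?U (exec n A (For ''a'' (agents) body) s0) \<and>
      J (nval agents s0) (exec n A (For ''a'' (agents) body) s0)"
  proof (rule For_invariant[where I = "\<lambda>m t. ?U t \<and> J m t"])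
    show "?U (tick 1 s0) \<and> J 0 (tick 1 s0)"
      using x0 by (simp add: J_def unchanged_def)
  next
    fix a t
    assume "a < nval agents s0" and t: "?U t \<and> J a t"
    then have a: "a < n" using x0(2) n(1) by (simp add: unchanged_def)
    define t0 where "t0 = tick 1 (set_reg ''a'' a t)"
    have U0: "?U t0" and a0: "regs t0 ''a'' = a" using t by (simp_all add: t0_def unchanged_def)
    have test: "bval (BAnd (RLess (RArr ''l'' []) (RArr ''v'' [NVar ''a'']))
        (RLess (RConst 0) (RArr ''r'' [NVar ''a'', NVar ''a'']))) t0 \<longleftrightarrow> demand v a"
      using demand_iff[OF v r[rule_format] a] a U0 a0 n by (simp add: unchanged_def)
    have "?U (exec n A body t0)"
      using U0 by (auto simp: unchanged_def body_def serve_def exec_regs exec_arrays)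
    moreover have "J (Suc a) (exec n A body t0)"
    proof (cases "demand v a")
      case False
      then have "exec n A body t0 = exec n A skip (tick 1 t0)"
        by (simp only: body_def exec.simps(4) test if_False)
      then have "arrays (exec n A body t0) = arrays t" by (simp add: t0_def)
      then have "J a (exec n A body t0)" using t by (simp add: J_def)
      moreover have "(\<exists>k<Suc a. demand v k) \<longleftrightarrow> (\<exists>k<a. demand v k)"
        using False by (metis less_Suc_eq)
      ultimately show ?thesis by (simp only: J_def)
    next
      case True
      define t1 where "t1 = exec n A (for_agents (Store ''x'' [NVar ''i''] (RConst 0))) (tick 1 t0)"
      have n0: "regs (tick 1 t0) ''n'' = n" using U0 n(1) by (simp add: unchanged_def)
      have x1: "arrays t1 ''x'' =
          (\<lambda>js. if \<exists>i<n. js = [] @ [i] then 0 else arrays (tick 1 t0) ''x'' js)"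
        "unchanged {''i''} {''x''} (tick 1 t0) t1"
        unfolding t1_def by (rule exec_for_agents[where pre = "[]" and f = "\<lambda>_. 0", OF n0]; simp)+
      have "arrays t1 ''r'' = arrays s ''r''" "arrays t1 ''y'' = arrays s ''y''"
        "regs t1 ''a'' = a" "regs t1 ''n'' = n"
        using x1(2) U0 a0 n(1) by (simp_all add: unchanged_def)
      moreover have "arrays s ''r'' [a, a] = low_alloc (tog v a) a"
        using demand_amount[OF True r[rule_format]] a by simp
      moreover have "exec n A body t0 = exec n A (Cond (RLess (RArr ''x'' [NVar ''a''])
            (RArr ''y'' [agents, agents, agents, agents, NVar ''a'']))
          (Store ''x'' [NVar ''a'']
            (RArr ''y'' [agents, agents, agents, agents, NVar ''a'']))
          skip) (exec n A (Store ''x'' [NVar ''a''] (RArr ''r'' [NVar ''a'', NVar ''a''])) t1)"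
        using True by (simp only: body_def serve_def t1_def exec.simps(3,4) test if_True)
      ultimately have "\<forall>i<n. arrays (exec n A body t0) ''x'' [i] = ?single a i"
        using x1(1) yn[OF a] a by (simp add: max_def)
      then show ?thesis using True by (auto simp: J_def)
    qed
    ultimately show "?U (exec n A body (tick 1 (set_reg ''a'' a t))) \<and>
        J (Suc a) (exec n A body (tick 1 (set_reg ''a'' a t)))"
      by (simp add: t0_def)
  qed
  moreover have "nval agents s0 = n" using x0(2) n(1) by (simp add: unchanged_def)
  moreover have "exec n A decide s = exec n A (For ''a'' (agents) body) s0"
    by (simp add: decide_def body_def serve_def s0_def)
  ultimately have J: "J n (exec n A decide s)" by simp
  have "(\<exists>k. demand v k) \<longleftrightarrow> (\<exists>k<n. demand v k)" by (auto simp: demand_def)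
  moreover have "preliminary v (\<lambda>i. arrays s ''r'' [n, i])"
    using r len by (metis order_refl tog_outside)
  ultimately show ?thesis using J by (auto simp: J_def outcome_def preliminary_def)
qed

end

section \<open>The transformation\<close>

text \<open>The three phases are chained: \<open>prepare\<close> writes none of \<open>l\<close>,
  \<open>v\<close> and \<open>y\<close>, so \<open>decide\<close> still finds the input and the
  recorded answers.\<close>

lemma outcome_serve_demands:
  assumes "two_valued lo hi (real_of_rat q) n A" and v: "v \<in> valuations lo hi n"
  shows "two_valued.outcome lo hi (real_of_rat q) n A v (\<lambda>i. transform (serve_demands q) lo hi A v ! i)"
    and "set (queries (final (serve_demands q) lo hi A v)) \<subseteq> valuations lo hi n"
proof -
  interpret two_valued lo hi "real_of_rat q" n A by fact
  have len: "length v = n" using v by (rule V_length)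
  define s where "s = initial lo hi v"
  define s1 where "s1 = exec n A ask s"
  define s2 where "s2 = exec n A (prepare q) s1"
  define s3 where "s3 = exec n A decide s2"
  have final: "final (serve_demands q) lo hi A v = s3"
    by (simp add: final_def serve_demands_def len s3_def s2_def s1_def s_def)
  have s: "regs s ''n'' = n" "arrays s ''l'' [] = lo" "arrays s ''h'' [] = hi" "queries s = []"
    "\<And>i. i < n \<Longrightarrow> arrays s ''v'' [i] = v ! i"
    by (simp_all add: s_def initial_def len)
  have ask: "holds v s1" "answered v ({..n} \<times> triples) s1" "set (queries s1) \<subseteq> V"
    unfolding s1_def using exec_ask[OF v s(1-3,5,4)] by blast+
  have v1: "arrays s1 ''v'' = arrays s ''v''"
    unfolding s1_def by (rule exec_arrays) (simp add: program_defs)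
  have prep: "\<forall>a\<le>n. preliminary (tog v a) (\<lambda>i. arrays s2 ''r'' [a, i])"
    unfolding s2_def by (rule exec_prepare[OF v ask(1,2) refl])
  have "regs s2 ''n'' = regs s1 ''n''"
    unfolding s2_def by (rule exec_regs) (simp add: program_defs)
  moreover have eq: "arrays s2 a = arrays s1 a" if "a \<in> {''l'', ''v'', ''y''}" for a
    unfolding s2_def by (rule exec_arrays) (use that in \<open>auto simp: program_defs\<close>)
  ultimately have s2: "regs s2 ''n'' = n" "arrays s2 ''l'' [] = lo"
    "\<And>i. i < n \<Longrightarrow> arrays s2 ''v'' [i] = v ! i" "answered v ({..n} \<times> triples) s2"
    using ask(1,2) s v1 by (simp_all add: holds_def answered_def)
  have "outcome v (\<lambda>i. arrays s3 ''x'' [i])"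
    unfolding s3_def by (rule exec_decide[OF v s2 prep])
  then show "outcome v (\<lambda>i. transform (serve_demands q) lo hi A v ! i)"
    by (rule outcome_cong) (simp add: transform_def get_vector_def final len)
  show "set (queries (final (serve_demands q) lo hi A v)) \<subseteq> V"
    using ask(3) by (simp add: final s3_def s2_def exec_queries query_free_rest)
qed

text \<open>Downward closure decreases one agent at a time. The hybrids with the first
  \<open>m\<close> amounts from \<open>x\<close> and the others from \<open>y\<close> lead from
  \<open>y\<close> to \<open>x\<close>.\<close>

lemma downward_closed_le:
  assumes F: "feasibility_set n F" "downward_closed F" and y: "y \<in> F"
    and x: "length x = n" "\<And>i. i < n \<Longrightarrow> 0 \<le> x ! i \<and> x ! i \<le> y ! i"
  shows "x \<in> F"
proof -
  have len: "length y = n" using F(1) y by (simp add: feasibility_set_def)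
  have "take m x @ drop m y \<in> F" if "m \<le> n" for m
    using that
  proof (induction m)
    case 0
    then show ?case using y by simp
  next
    case (Suc m)
    let ?z = "take m x @ drop m y"
    have "?z \<in> F" "m < length ?z" "?z ! m = y ! m"
      using Suc x(1) len by (auto simp: nth_append)
    then have "?z[m := x ! m] \<in> F"
      using F(2) x(2)[of m] Suc.prems unfolding downward_closed_def by auto
    moreover have "?z[m := x ! m] = take (Suc m) x @ drop (Suc m) y"
      using Suc.prems x(1) len
      by (simp add: list_update_append take_Suc_conv_app_nth Cons_nth_drop_Suc[symmetric])
    ultimately show ?case by simp
  qed
  from this[of n] show ?thesis using x(1) len by simp
qed

text \<open>The asymptotic bound holds only from some \<open>n0\<close> on. For the finitely many
  smaller \<open>n\<close>, a positive \<open>l n\<close> below \<open>h n\<close> gives a ratio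
  above 1, so a small enough constant works for all \<open>n\<close>. It is rational because
  programs contain rational constants only.\<close>

lemma bigomega_uniform:
  fixes l h :: "nat \<Rightarrow> real"
  assumes less: "\<And>n. l n < h n" and omega: "(\<lambda>n. h n / l n) \<in> \<Omega>(\<lambda>n. real n)"
  obtains q :: rat where "0 < q" "q \<le> 1" "\<And>n. 0 < l n \<Longrightarrow> 2 * real_of_rat q * real n * l n \<le> h n"
proof -
  obtain c where c: "0 < c" and ev: "eventually (\<lambda>n. c * norm (real n) \<le> norm (h n / l n)) sequentially"
    using omega by (auto simp: bigomega_def)
  then obtain n0 where n0: "\<And>n. n \<ge> n0 \<Longrightarrow> c * real n \<le> \<bar>h n / l n\<bar>"
    by (auto simp: eventually_sequentially)
  \<comment> \<open>Below \<open>c / 2\<close>, the number 2 q n is at most c n, for large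
    \<open>n\<close>; below the last term it is at most 1 for \<open>n\<close> less than
    \<open>n0\<close>; the bound 1 yields \<open>q \<le> 1\<close>.\<close>
  define b where "b = min 1 (min (c / 2) (1 / (2 * (real n0 + 1))))"
  have "0 < b" using c by (simp add: b_def)
  then obtain q where q: "0 < real_of_rat q" "real_of_rat q < b"
    using of_rat_dense[of 0 b] by auto
  have "2 * real_of_rat q * real n * l n \<le> h n" if l: "0 < l n" for n
  proof -
    have "2 * real_of_rat q * real n \<le> h n / l n"
    proof (cases "n0 \<le> n")
      case True
      have "2 * real_of_rat q * real n \<le> c * real n"
        using q by (intro mult_right_mono) (auto simp: b_def)
      also have "\<dots> \<le> h n / l n" using n0[OF True] l less[of n] by simp
      finally show ?thesis .
    next
      case False
      have "2 * real_of_rat q * real n \<le> 2 * (1 / (2 * (real n0 + 1))) * (real n0 + 1)"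
        using q False by (intro mult_mono) (auto simp: b_def)
      also have "\<dots> = 1" by simp
      also have "1 \<le> h n / l n" using l less[of n] by simp
      finally show ?thesis .
    qed
    then show ?thesis using l by (simp add: pos_le_divide_eq)
  qed
  moreover have "q \<le> 1" using q by (simp add: b_def)
  ultimately show ?thesis using that q(1) by simp
qed

theorem theorem5:
  fixes l h :: "nat \<Rightarrow> real"
  assumes "\<And>n. l n < h n"
    and "(\<lambda>n. h n / l n) \<in> \<Omega>(\<lambda>n. real n)"
  shows "\<exists>T. transformation l h T \<and> nonadaptive l h T \<and> polynomial_time l h T \<and>
           monotone_transformation l h T \<and> constant_fraction_welfare_preserving l h T"
proof -
  obtain q :: rat where q: "0 < q" "q \<le> 1"
    and ratio: "\<And>n. 0 < l n \<Longrightarrow> 2 * real_of_rat q * real n * l n \<le> h n"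
    using bigomega_uniform[OF assms] by blast
  \<comment> \<open>\<open>q\<close> depends on the sequences \<open>l\<close> and \<open>h\<close>
    but not on \<open>n\<close>, so one program serves all numbers of agents and the welfare
    constant is uniform.\<close>
  let ?T = "serve_demands q"
  have tv: "two_valued (l n) (h n) (real_of_rat q) n A" if "instance_of l h n F A" for n F A
  proof
    show "0 \<le> A u ! i" if "u \<in> valuations (l n) (h n) n" "i < n" for u i
      using that \<open>instance_of l h n F A\<close>
      by (auto simp: instance_of_def algorithm_def feasibility_set_def)
  qed (use assms(1) q ratio in auto)
  have len: "length (transform ?T lo hi A v) = length v" for lo hi A v
    by (simp add: transform_def get_vector_def)
  have "algorithm (l n) (h n) n F (transform ?T (l n) (h n) A)" if i: "instance_of l h n F A" for n F A
    unfolding algorithm_def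
  proof
    fix v assume v: "v \<in> valuations (l n) (h n) n"
    interpret two_valued "l n" "h n" "real_of_rat q" n A by (rule tv[OF i])
    obtain w where w: "w \<in> V"
      "\<forall>i<n. 0 \<le> transform ?T (l n) (h n) A v ! i \<and> transform ?T (l n) (h n) A v ! i \<le> A w ! i"
      using outcome_bounded[OF v outcome_serve_demands(1)[OF tv[OF i] v]] by blast
    show "transform ?T (l n) (h n) A v \<in> F"
      by (rule downward_closed_le[where y = "A w" and n = n])
        (use i w v in \<open>auto simp: instance_of_def algorithm_def len V_length\<close>)
  qed
  moreover have "set (queries (final ?T (l n) (h n) A v)) \<subseteq> valuations (l n) (h n) n"
    if "instance_of l h n F A" "v \<in> valuations (l n) (h n) n" for n F A v
    using outcome_serve_demands(2)[OF tv[OF that(1)] that(2)] .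
  ultimately have "transformation l h ?T" by (simp add: transformation_def)
  moreover have "monotone_rule (l n) (h n) n (transform ?T (l n) (h n) A)"
    if i: "instance_of l h n F A" for n F A
  proof -
    interpret two_valued "l n" "h n" "real_of_rat q" n A by (rule tv[OF i])
    show ?thesis
      unfolding monotone_rule_def
    proof (intro ballI allI impI)
      fix v j b
      assume a: "v \<in> V" "j < n" "b \<in> {l n, h n}" "v ! j \<le> b"
      have "v[j := b] \<in> V"
        using a set_update_subset_insert[of v j b] by (auto simp: valuations_def)
      \<comment> \<open>If the update changes nothing, both amounts come from the same deterministic
        run, which settles the assumption \<open>same\<close>.\<close>
      then show "transform ?T (l n) (h n) A v ! j \<le> transform ?T (l n) (h n) A (v[j := b]) ! j"
        by (intro outcome_monotone[OF a(1) outcome_serve_demands(1)[OF tv[OF i] a(1)]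
              outcome_serve_demands(1)[OF tv[OF i]] a(2-4)]) simp_all
    qed
  qed
  then have "monotone_transformation l h ?T" by (auto simp: monotone_transformation_def)
  moreover have "real_of_rat q / 4 * welfare v (A v) \<le> welfare v (transform ?T (l n) (h n) A v)"
    if i: "instance_of l h n F A" and v: "v \<in> valuations (l n) (h n) n" for n F A v
  proof -
    interpret two_valued "l n" "h n" "real_of_rat q" n A by (rule tv[OF i])
    have "map (\<lambda>i. transform ?T (l n) (h n) A v ! i) [0..<n] = transform ?T (l n) (h n) A v"
      using len[of "l n" "h n" A v] V_length[OF v] by (metis map_nth)
    then show ?thesis
      using outcome_welfare[OF v outcome_serve_demands(1)[OF tv[OF i] v]] by simp
  qed
  then have "constant_fraction_welfare_preserving l h ?T"
    unfolding constant_fraction_welfare_preserving_def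
    using q by (intro exI[of _ "real_of_rat q / 4"]) auto
  ultimately show ?thesis
    using nonadaptive_serve_demands polynomial_time_serve_demands by blast
qed

end
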